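(* Let $n\ge 3$ be odd, and let the inter-agent graph be either the undirected ring ($\mathcal N_i=\{i-1,i+1\}$ for all $i\in\mathcal V$) or the directed ring ($\mathcal N_i=\{i+1\}$ for all $i\in\mathcal V$), indices modulo $n$. Consider the closed-loop system on $(\mathcal S^2)^n$ $$\dot\Gamma_i=\Gamma_i\times\Big(\Gamma_i\times\sum_{j\in\mathcal N_i}\Gamma_j\Big),\qquad i=1,\dots,n.$$ Then the invariant set $$\mathcal M_o=\{\mathbf\Gamma\in(\mathcal S^2)^n:\ \exists u,v\in\mathcal S^2,\ u^Tv=0,\ \Gamma_i=\exp\big((i-1)(\pi-\pi/n)\widehat u\big)v\ \ \forall i\in\mathcal V\}$$ is asymptotically stable, with region of attraction containing $$\Omega_o=\{\mathbf\Gamma\in(\mathcal S^2)^n:\ W(\mathbf\Gamma)>\max\{\pi-3\pi/n,\ \pi/2\}\}.$$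
   Context: $\mathcal S^2=\{x\in\mathbb R^3:\|x\|=1\}$, $\mathcal V=\{1,\dots,n\}$, and indices are taken modulo $n$ (so $n+1$ means $1$ and $0$ means $n$). For $x\in\mathbb R^3$, $\widehat x$ is the skew-symmetric matrix with $\widehat x y=x\times y$ for all $y\in\mathbb R^3$, and $\exp$ is the matrix exponential. Points of $(\mathcal S^2)^n$ are written $\mathbf\Gamma=\{\Gamma_i\}_{i\in\mathcal V}$. The geodesic distance is $d_{\mathcal S^2}(\Gamma_i,\Gamma_j)=\theta_{ij}=\arccos(\Gamma_i^T\Gamma_j)\in[0,\pi]$, and $W(\mathbf\Gamma)=\min_{i\in\mathcal V}d_{\mathcal S^2}(\Gamma_i,\Gamma_{i+1})$. The metric on $(\mathcal S^2)^n$ is $d_{(\mathcal S^2)^n}(\mathbf\Gamma,\bar{\mathbf\Gamma})=\max_{i}d_{\mathcal S^2}(\Gamma_i,\bar\Gamma_i)$, and for a set $\mathcal M$, $d_{\mathcal M}(\mathbf\Gamma)=\inf_{\bar{\mathbf\Gamma}\in\mathcal M}d_{(\mathcal S^2)^n}(\mathbf\Gamma,\bar{\mathbf\Gamma})$. A positively invariant set $\mathcal M$ is stable if for every $\varepsilon>0$ there is $\delta>0$ such that $d_{\mathcal M}(\mathbf\Gamma(0))<\delta$ implies $d_{\mathcal M}(\mathbf\Gamma(t))<\varepsilon$ for all $t\ge0$. It is asymptotically stable with region of attraction containing $\Omega$ (where $\Omega$ contains a neighborhood of $\mathcal M$) if it is stable and $\lim_{t\to\infty}d_{\mathcal M}(\mathbf\Gamma(t))=0$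 for every trajectory with $\mathbf\Gamma(0)\in\Omega$. *)

theory Defs
  imports "HOL-Analysis.Analysis"
begin

unbundle cross3_syntax

text \<open>Agents are the indices \<open>1, \<dots>, n\<close>; a configuration is a function \<open>nat \<Rightarrow> real ^ 3\<close> that
  only matters on \<open>{1..n}\<close>, so the state space is taken to be the extensional product.\<close>

type_synonym config = "nat \<Rightarrow> real ^ 3"

definition S2 :: "(real ^ 3) set" where
  "S2 = sphere 0 1"

definition S2_pow :: "nat \<Rightarrow> config set" where
  "S2_pow n = (\<Pi>\<^sub>E i\<in>{1..n}. S2)"

definition hat :: "real ^ 3 \<Rightarrow> real ^ 3 ^ 3" where
  "hat x = matrix (\<lambda>y. x \<times> y)"

lemma hat_mult: "hat x *v y = x \<times> y"
proof -
  have "linear (\<lambda>y. x \<times> y)"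
    using bilinear_cross by (simp add: bilinear_def)
  then show ?thesis
    by (simp add: hat_def matrix_works)
qed

text \<open>\<open>real ^ 'n ^ 'n\<close> is not an instance of the algebra class required by \<open>exp\<close>, so the matrix
  exponential is given by its power series with respect to \<open>**\<close>.\<close>

definition mat_exp :: "real ^ 'n ^ 'n \<Rightarrow> real ^ 'n ^ 'n" where
  "mat_exp A = (\<Sum>k. (1 / fact k) *\<^sub>R (((**) A ^^ k) (mat 1)))"

definition dist_S2 :: "real ^ 3 \<Rightarrow> real ^ 3 \<Rightarrow> real" where
  "dist_S2 x y = arccos (x \<bullet> y)"

definition dist_S2_pow :: "nat \<Rightarrow> config \<Rightarrow> config \<Rightarrow> real" where
  "dist_S2_pow n \<Gamma> \<Gamma>' = (MAX i\<in>{1..n}. dist_S2 (\<Gamma> i) (\<Gamma>' i))"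

text \<open>The infimum is one of real numbers, hence only meaningful for nonempty \<open>M\<close>.\<close>

definition dist_to_set :: "nat \<Rightarrow> config set \<Rightarrow> config \<Rightarrow> real" where
  "dist_to_set n M \<Gamma> = (INF \<Gamma>'\<in>M. dist_S2_pow n \<Gamma> \<Gamma>')"

definition next_idx :: "nat \<Rightarrow> nat \<Rightarrow> nat" where
  "next_idx n i = (if i = n then 1 else i + 1)"

definition prev_idx :: "nat \<Rightarrow> nat \<Rightarrow> nat" where
  "prev_idx n i = (if i = 1 then n else i - 1)"

definition undirected_ring :: "nat \<Rightarrow> nat \<Rightarrow> nat set" where
  "undirected_ring n i = {prev_idx n i, next_idx n i}"

definition directed_ring :: "nat \<Rightarrow> nat \<Rightarrow> nat set" where
  "directed_ring n i = {next_idx n i}"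

definition closed_loop :: "(nat \<Rightarrow> nat set) \<Rightarrow> config \<Rightarrow> config" where
  "closed_loop N \<Gamma> i = \<Gamma> i \<times> (\<Gamma> i \<times> (\<Sum>j\<in>N i. \<Gamma> j))"

text \<open>Only the values at times \<open>t \<ge> 0\<close> matter; the derivative at \<open>0\<close> is one-sided.\<close>

definition trajectory :: "nat \<Rightarrow> (config \<Rightarrow> config) \<Rightarrow> (real \<Rightarrow> config) \<Rightarrow> bool" where
  "trajectory n F \<Gamma> \<longleftrightarrow>
     (\<forall>t\<ge>0. \<Gamma> t \<in> S2_pow n) \<and>
     (\<forall>t\<ge>0. \<forall>i\<in>{1..n}. ((\<lambda>s. \<Gamma> s i) has_vector_derivative F (\<Gamma> t) i) (at t within {0..}))"

definition positively_invariant :: "nat \<Rightarrow> (config \<Rightarrow> config) \<Rightarrow> config set \<Rightarrow> bool" where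
  "positively_invariant n F M \<longleftrightarrow>
     M \<subseteq> S2_pow n \<and>
     (\<forall>\<Gamma>. trajectory n F \<Gamma> \<longrightarrow> \<Gamma> 0 \<in> M \<longrightarrow> (\<forall>t\<ge>0. \<Gamma> t \<in> M))"

definition stable_set :: "nat \<Rightarrow> (config \<Rightarrow> config) \<Rightarrow> config set \<Rightarrow> bool" where
  "stable_set n F M \<longleftrightarrow>
     positively_invariant n F M \<and>
     (\<forall>\<epsilon>>0. \<exists>\<delta>>0. \<forall>\<Gamma>. trajectory n F \<Gamma> \<longrightarrow> dist_to_set n M (\<Gamma> 0) < \<delta> \<longrightarrow>
        (\<forall>t\<ge>0. dist_to_set n M (\<Gamma> t) < \<epsilon>))"

definition contains_neighborhood :: "nat \<Rightarrow> config set \<Rightarrow> config set \<Rightarrow> bool" where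
  "contains_neighborhood n \<Omega> M \<longleftrightarrow>
     (\<forall>\<Gamma>\<in>M. \<exists>\<epsilon>>0. \<forall>\<Gamma>'\<in>S2_pow n. dist_S2_pow n \<Gamma> \<Gamma>' < \<epsilon> \<longrightarrow> \<Gamma>' \<in> \<Omega>)"

definition asymptotically_stable_on ::
    "nat \<Rightarrow> (config \<Rightarrow> config) \<Rightarrow> config set \<Rightarrow> config set \<Rightarrow> bool" where
  "asymptotically_stable_on n F M \<Omega> \<longleftrightarrow>
     stable_set n F M \<and>
     contains_neighborhood n \<Omega> M \<and>
     (\<forall>\<Gamma>. trajectory n F \<Gamma> \<longrightarrow> \<Gamma> 0 \<in> \<Omega> \<longrightarrow>
        ((\<lambda>t. dist_to_set n M (\<Gamma> t)) \<longlongrightarrow> 0) at_top)"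

definition W :: "nat \<Rightarrow> config \<Rightarrow> real" where
  "W n \<Gamma> = (MIN i\<in>{1..n}. dist_S2 (\<Gamma> i) (\<Gamma> (next_idx n i)))"

definition M_o :: "nat \<Rightarrow> config set" where
  "M_o n = {\<Gamma> \<in> S2_pow n. \<exists>u\<in>S2. \<exists>v\<in>S2. u \<bullet> v = 0 \<and>
     (\<forall>i\<in>{1..n}. \<Gamma> i = mat_exp (((real i - 1) * (pi - pi / real n)) *\<^sub>R hat u) *v v)}"

definition Omega_o :: "nat \<Rightarrow> config set" where
  "Omega_o n = {\<Gamma> \<in> S2_pow n. W n \<Gamma> > max (pi - 3 * pi / real n) (pi / 2)}"

end

theory Submission
  imports Defs
begin

text \<open>The proof rests on two quantities that are monotone along trajectories of both rings. Let
  \<open>edge_cos n \<Gamma> i\<close> be the inner product of \<open>\<Gamma> i\<close> and its successor, let \<open>energy n \<Gamma>\<close> be the sum of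
  the edge cosines, and let \<open>ring_defect n \<Gamma> i\<close> be the tangential part at \<open>\<Gamma> i\<close> of the sum of
  the two neighbours of \<open>i\<close> in the cycle, also when the ring is directed.

  The first quantity is the energy. Its derivative is \<open>- \<kappa>\<close> times the sum of the squared norms of the
  defects, with \<open>\<kappa> = 1\<close> for the undirected and \<open>\<kappa> = 1 / 2\<close> for the directed ring
  (\<open>energy_derivative\<close>). In the undirected case this is a gradient flow; in the directed case the
  same formula appears after summation by parts around the ring, so the two cases need no
  further distinction. Moreover \<open>M_o n\<close> is exactly the set of global minimizers of the energy
  (\<open>energy_minimum\<close>), which together with compactness yields invariance and stability.

  The second quantity is the largest edge cosine, that is, the length of the shortest edge. As long as
  all edges are obtuse, the shortest edge does not shrink (\<open>edge_cos_barrier\<close>). Hence a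
  trajectory that starts in \<open>Omega_o n\<close> keeps all edges obtuse and longer than
  \<open>pi - 3 * pi / n\<close>. By Barbalat's lemma the defects tend to 0. A configuration with vanishing defects and
  obtuse edges has all edges equal, so its agents walk around a great circle in equal
  steps \<open>\<theta>\<close> with \<open>n * \<theta>\<close> a multiple of \<open>2 * pi\<close>. For odd \<open>n\<close> and \<open>\<theta> > pi - 3 * pi / n\<close> this
  leaves only \<open>\<theta> = pi - pi / n\<close>, which is \<open>M_o n\<close>
  (\<open>critical_equal_edges_in_M_o\<close>). Compactness then turns small defects into small distance to
  \<open>M_o n\<close>.\<close>

section \<open>Rodrigues' rotation formula\<close>

text \<open>This identity makes the powers of \<open>hat u\<close> periodic up to sign, so that the exponential series
  splits into a sine series times \<open>hat u\<close> and a cosine series times \<open>(hat u)\<^sup>2\<close>.\<close>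

lemma hat_cube:
  assumes "norm u = 1"
  shows "hat u ** (hat u ** hat u) = - hat u"
proof -
  have "hat u *v (hat u *v (hat u *v y)) = - (hat u *v y)" for y
    using assms by (simp add: hat_mult Lagrange[of u u "u \<times> y"] dot_cross_self norm_eq_1)
  then show ?thesis
    using matrix_vector_mult_diff_rdistrib[of 0 "hat u"]
    by (subst matrix_eq) (simp add: matrix_vector_mul_assoc[symmetric])
qed

text \<open>The constant term needs the extra summand, because the cosine series contributes
  \<open>- (hat u)\<^sup>2\<close> at \<open>k = 0\<close> where the exponential series has the identity. The recursions of
  \<open>sin_coeff\<close> and \<open>cos_coeff\<close> exchange the two coefficients exactly as multiplication by
  \<open>hat u\<close> exchanges \<open>hat u\<close> and \<open>(hat u)\<^sup>2\<close>.\<close>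

lemma exp_series_term_hat:
  assumes "norm u = 1"
  shows "(1 / fact k) *\<^sub>R (((**) (t *\<^sub>R hat u) ^^ k) (mat 1)) =
     (if k = 0 then mat 1 + hat u ** hat u else 0)
     + (sin_coeff k *\<^sub>R t ^ k) *\<^sub>R hat u - (cos_coeff k *\<^sub>R t ^ k) *\<^sub>R (hat u ** hat u)"
    (is "?T k = ?R k")
proof (induction k)
  case 0
  show ?case by simp
next
  case (Suc k)
  have smul: "(c *\<^sub>R A) ** B = c *\<^sub>R (A ** B)" "A ** (c *\<^sub>R B) = c *\<^sub>R (A ** B)"
    for c :: real and A B :: "real^3^3"
    by (simp_all add: matrix_matrix_mult_def vec_eq_iff sum_distrib_left algebra_simps)
  have sadd: "A ** (B + C) = A ** B + A ** C" "A ** (B - C) = A ** B - A ** C" for A B C :: "real^3^3"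
    by (simp_all add: matrix_matrix_mult_def vec_eq_iff sum.distrib sum_subtractf algebra_simps)
  have "?T (Suc k) = (t / real (Suc k)) *\<^sub>R (hat u ** ?T k)"
    by (simp add: smul field_simps)
  also have "hat u ** ?T k = hat u ** ?R k"
    by (simp only: Suc.IH)
  also have "\<dots> = (sin_coeff k * t ^ k) *\<^sub>R (hat u ** hat u) + (cos_coeff k * t ^ k) *\<^sub>R hat u"
    using hat_cube[OF assms] by (simp add: sadd smul)
  finally show ?case
    by (simp add: sin_coeff_Suc cos_coeff_Suc scaleR_add_right algebra_simps)
qed

text \<open>Rodrigues' rotation formula.\<close>

lemma mat_exp_hat:
  assumes "norm u = 1"
  shows "mat_exp (t *\<^sub>R hat u) = mat 1 + sin t *\<^sub>R hat u + (1 - cos t) *\<^sub>R (hat u ** hat u)"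
proof -
  let ?Z = "mat 1 + hat u ** hat u"
  have "(\<lambda>k. if k = 0 then ?Z else 0) sums ?Z"
    using sums_single[of 0 "\<lambda>_. ?Z"] by simp
  then have "(\<lambda>k. (if k = 0 then ?Z else 0) + (sin_coeff k *\<^sub>R t ^ k) *\<^sub>R hat u
        - (cos_coeff k *\<^sub>R t ^ k) *\<^sub>R (hat u ** hat u))
      sums (?Z + sin t *\<^sub>R hat u - cos t *\<^sub>R (hat u ** hat u))"
    by (intro sums_diff sums_add sums_scaleR_left sin_converges cos_converges)
  then show ?thesis
    unfolding mat_exp_def exp_series_term_hat[OF assms]
    by (simp add: sums_iff algebra_simps)
qed

lemma mat_exp_hat_apply:
  assumes "norm u = 1" and "u \<bullet> v = 0"
  shows "mat_exp (t *\<^sub>R hat u) *v v = cos t *\<^sub>R v + sin t *\<^sub>R (u \<times> v)"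
proof -
  have "mat_exp (t *\<^sub>R hat u) *v v = v + sin t *\<^sub>R (u \<times> v) + (1 - cos t) *\<^sub>R (u \<times> (u \<times> v))"
    by (simp add: mat_exp_hat[OF assms(1)] matrix_vector_mult_add_rdistrib scaleR_matrix_vector_assoc[symmetric]
        matrix_vector_mul_assoc[symmetric] hat_mult)
  also have "u \<times> (u \<times> v) = - v"
    using assms by (simp add: Lagrange norm_eq_1)
  finally show ?thesis
    by (simp add: algebra_simps)
qed

section \<open>Edges of the ring\<close>

definition edge_cos :: "nat \<Rightarrow> config \<Rightarrow> nat \<Rightarrow> real" where
  "edge_cos n \<Gamma> i = \<Gamma> i \<bullet> \<Gamma> (next_idx n i)"

definition tangent_part :: "real ^ 3 \<Rightarrow> real ^ 3 \<Rightarrow> real ^ 3" where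
  "tangent_part x v = v - (x \<bullet> v) *\<^sub>R x"

text \<open>Up to sign, the velocity of agent \<open>i\<close> in the undirected ring, and the tangential
  gradient with respect to \<open>\<Gamma> i\<close> of the sum of all edge cosines.\<close>

definition ring_defect :: "nat \<Rightarrow> config \<Rightarrow> nat \<Rightarrow> real ^ 3" where
  "ring_defect n \<Gamma> i = tangent_part (\<Gamma> i) (\<Gamma> (prev_idx n i) + \<Gamma> (next_idx n i))"

lemma S2_powD:
  assumes "\<Gamma> \<in> S2_pow n" "i \<in> {1..n}"
  shows "norm (\<Gamma> i) = 1" "\<Gamma> i \<bullet> \<Gamma> i = 1"
  using assms by (auto simp: S2_pow_def S2_def PiE_iff norm_eq_1)

lemma next_idx_in: "i \<in> {1..n} \<Longrightarrow> next_idx n i \<in> {1..n}"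
  and prev_idx_in: "i \<in> {1..n} \<Longrightarrow> prev_idx n i \<in> {1..n}"
  and next_prev_idx: "i \<in> {1..n} \<Longrightarrow> next_idx n (prev_idx n i) = i"
  and prev_next_idx: "i \<in> {1..n} \<Longrightarrow> prev_idx n (next_idx n i) = i"
  by (auto simp: next_idx_def prev_idx_def)

lemma sum_next_idx: "(\<Sum>i\<in>{1..n}. f (next_idx n i)) = (\<Sum>i\<in>{1..n}. f i)"
  by (rule sum.reindex_bij_witness[where i = "prev_idx n" and j = "next_idx n"])
     (use next_idx_in[of _ n] prev_idx_in[of _ n] in \<open>simp_all add: next_prev_idx prev_next_idx\<close>)

lemma sum_prev_idx: "(\<Sum>i\<in>{1..n}. f (prev_idx n i)) = (\<Sum>i\<in>{1..n}. f i)"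
proof -
  have "(\<Sum>i\<in>{1..n}. f (prev_idx n i)) = (\<Sum>i\<in>{1..n}. f (prev_idx n (next_idx n i)))"
    by (rule sum_next_idx[symmetric])
  also have "\<dots> = (\<Sum>i\<in>{1..n}. f i)"
    by (rule sum.cong) (simp_all add: prev_next_idx)
  finally show ?thesis .
qed

lemma inner_unit_bounds:
  fixes x y :: "'a::real_inner"
  assumes "norm x = 1" "norm y = 1"
  shows "- 1 \<le> x \<bullet> y" "x \<bullet> y \<le> 1"
  using Cauchy_Schwarz_ineq2[of x y] assms by auto

section \<open>Critical configurations on a great circle\<close>

text \<open>When \<open>b = a\<close> or \<open>b = - a\<close> the sine vanishes and any unit vector orthogonal to \<open>a\<close> will do;
  this keeps the degenerate arcs out of the argument about recurrences below.\<close>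

lemma unit_vector_decomposition:
  fixes a b :: "real ^ 3"
  assumes a: "norm a = 1" and b: "norm b = 1"
  obtains w where "norm w = 1" "a \<bullet> w = 0" "b = (a \<bullet> b) *\<^sub>R a + sin (arccos (a \<bullet> b)) *\<^sub>R w"
proof -
  define r where "r = b - (a \<bullet> b) *\<^sub>R a"
  have aa: "a \<bullet> a = 1" "b \<bullet> b = 1" using a b by (simp_all add: norm_eq_1)
  have ar: "a \<bullet> r = 0" by (simp add: r_def inner_diff_right aa)
  have "r \<bullet> r = 1 - (a \<bullet> b)\<^sup>2"
    by (simp add: r_def inner_diff_right inner_diff_left aa inner_commute power2_eq_square)
  then have nr: "norm r = sin (arccos (a \<bullet> b))"
    using inner_unit_bounds[OF a b] by (simp add: norm_eq_sqrt_inner sin_arccos)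
  show ?thesis
  proof (cases "r = 0")
    case True
    obtain p :: "real ^ 3" where "p \<noteq> 0" "orthogonal a p"
      using orthogonal_to_vector_exists[of a] by auto
    then show ?thesis
      using True nr that[of "p /\<^sub>R norm p"] by (simp add: orthogonal_def r_def)
  next
    case False
    then have "norm (r /\<^sub>R norm r) = 1" "a \<bullet> (r /\<^sub>R norm r) = 0"
      and "b = (a \<bullet> b) *\<^sub>R a + norm r *\<^sub>R (r /\<^sub>R norm r)"
      using ar by (simp_all add: r_def[symmetric]) (simp add: r_def)
    then show ?thesis
      using that unfolding nr by blast
  qed
qed

text \<open>Both \<open>cos (k * \<theta>)\<close> and \<open>sin (k * \<theta>)\<close> satisfy the three-term recurrence, so a solution
  of it moves on an ellipse in a fixed plane.\<close>

lemma chebyshev_recurrence: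
  fixes y :: "nat \<Rightarrow> 'a::real_vector"
  assumes rec: "\<And>k. y (Suc (Suc k)) = (2 * cos \<theta>) *\<^sub>R y (Suc k) - y k"
    and y1: "y 1 = cos \<theta> *\<^sub>R y 0 + sin \<theta> *\<^sub>R w"
  shows "y k = cos (real k * \<theta>) *\<^sub>R y 0 + sin (real k * \<theta>) *\<^sub>R w"
proof (induction k rule: nat_less_induct)
  case (1 k)
  consider "k = 0" | "k = 1" | j where "k = Suc (Suc j)"
    by (metis One_nat_def old.nat.exhaust)
  then show ?case
  proof cases
    case 3
    let ?a = "real (Suc j) * \<theta>"
    have arg: "real k * \<theta> = ?a + \<theta>" "real j * \<theta> = ?a - \<theta>"
      by (simp_all add: 3 algebra_simps)
    have IH: "y (Suc j) = cos ?a *\<^sub>R y 0 + sin ?a *\<^sub>R w"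
      "y j = cos (?a - \<theta>) *\<^sub>R y 0 + sin (?a - \<theta>) *\<^sub>R w"
      using 1[rule_format, of "Suc j"] 1[rule_format, of j] unfolding arg(2) by (simp_all only: 3 lessI less_SucI)
    have "y k = (2 * cos \<theta>) *\<^sub>R (cos ?a *\<^sub>R y 0 + sin ?a *\<^sub>R w)
        - (cos (?a - \<theta>) *\<^sub>R y 0 + sin (?a - \<theta>) *\<^sub>R w)"
      unfolding 3 rec[of j] IH ..
    also have "\<dots> = (2 * cos \<theta> * cos ?a - cos (?a - \<theta>)) *\<^sub>R y 0
        + (2 * cos \<theta> * sin ?a - sin (?a - \<theta>)) *\<^sub>R w"
      by (simp add: algebra_simps)
    also have "\<dots> = cos (?a + \<theta>) *\<^sub>R y 0 + sin (?a + \<theta>) *\<^sub>R w"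
      by (simp add: cos_add cos_diff sin_add sin_diff mult.commute)
    finally show ?thesis by (simp add: arg(1))
  qed (use y1 in auto)
qed

text \<open>A vanishing defect says \<open>\<Gamma>\<^bsub>i-1\<^esub> + \<Gamma>\<^bsub>i+1\<^esub> = 2 g \<Gamma>\<^bsub>i\<^esub>\<close>, so the agents walk along a great circle in
  steps of \<open>\<theta> = arccos g\<close>. The walk closes after \<open>n\<close> steps, whence \<open>n * \<theta> = 2 * pi * j\<close>. The bound on
  \<open>\<theta>\<close> leaves \<open>n - 3 < 2 * j \<le> n\<close>, and since \<open>n\<close> is odd the only choice is \<open>2 * j = n - 1\<close>.\<close>

lemma critical_equal_edges_in_M_o:
  assumes n: "n \<ge> 3" and odd: "odd n" and \<Gamma>: "\<Gamma> \<in> S2_pow n"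
    and defect: "\<And>i. i \<in> {1..n} \<Longrightarrow> ring_defect n \<Gamma> i = 0"
    and edges: "\<And>i. i \<in> {1..n} \<Longrightarrow> edge_cos n \<Gamma> i = g"
    and g: "arccos g > pi - 3 * pi / real n"
  shows "\<Gamma> \<in> M_o n"
proof -
  define \<theta> where "\<theta> = arccos g"
  \<comment> \<open>Unrolling the ring into a sequence of period \<open>n\<close> that starts at agent 1.\<close>
  define y where "y k = \<Gamma> (k mod n + 1)" for k
  have idx: "k mod n + 1 \<in> {1..n}" for k
    using n by (simp add: Suc_leI)
  have nidx: "next_idx n (k mod n + 1) = Suc k mod n + 1" for k
    using n by (auto simp: next_idx_def mod_Suc)
  have pidx: "prev_idx n (Suc k mod n + 1) = k mod n + 1" for k
    using prev_next_idx[OF idx[of k]] unfolding nidx .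
  have y_unit: "norm (y k) = 1" "y k \<bullet> y k = 1" for k
    using S2_powD[OF \<Gamma> idx] by (simp_all add: y_def)
  have y_edge: "y k \<bullet> y (Suc k) = g" for k
    using edges[OF idx[of k]] by (simp add: y_def edge_cos_def nidx[simplified])
  have g_bounds: "- 1 \<le> g" "g \<le> 1"
    using inner_unit_bounds[OF y_unit(1) y_unit(1), of 0 1] y_edge[of 0] by auto
  have cos_th: "cos \<theta> = g" and th: "0 \<le> \<theta>" "\<theta> \<le> pi"
    using g_bounds by (simp_all add: \<theta>_def arccos_lbound arccos_ubound)
  have rec: "y (Suc (Suc k)) = (2 * cos \<theta>) *\<^sub>R y (Suc k) - y k" for k
  proof -
    have "ring_defect n \<Gamma> (Suc k mod n + 1) = 0"
      by (rule defect) (rule idx)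
    then have "y k + y (Suc (Suc k)) = (y (Suc k) \<bullet> (y k + y (Suc (Suc k)))) *\<^sub>R y (Suc k)"
      by (simp add: ring_defect_def tangent_part_def y_def nidx[simplified] pidx[simplified])
    also have "y (Suc k) \<bullet> (y k + y (Suc (Suc k))) = 2 * g"
      using y_edge[of k] y_edge[of "Suc k"] by (simp add: inner_add_right inner_commute)
    finally show ?thesis by (simp add: cos_th algebra_simps)
  qed
  obtain w where w: "norm w = 1" "y 0 \<bullet> w = 0" "y 1 = g *\<^sub>R y 0 + sin \<theta> *\<^sub>R w"
    using unit_vector_decomposition[OF y_unit(1)[of 0] y_unit(1)[of 1]] y_edge[of 0]
    by (auto simp: \<theta>_def)
  have y_eq: "y k = cos (real k * \<theta>) *\<^sub>R y 0 + sin (real k * \<theta>) *\<^sub>R w" for k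
    using chebyshev_recurrence[of y \<theta> w k] rec w(3) by (simp add: cos_th)
  have "y n = y 0"
    by (simp add: y_def)
  then have "y 0 \<bullet> y 0 = cos (real n * \<theta>) * (y 0 \<bullet> y 0) + sin (real n * \<theta>) * (y 0 \<bullet> w)"
    using y_eq[of n] by (metis inner_add_right inner_scaleR_right)
  then have "cos (real n * \<theta>) = 1"
    by (simp add: y_unit w)
  then obtain j :: int where j: "real n * \<theta> = of_int j * 2 * pi"
    using cos_one_2pi_int by blast
  have "real n * \<theta> \<le> real n * pi"
    using th by (simp add: mult_left_mono)
  then have "2 * of_int j * pi \<le> real n * pi" unfolding j by (simp add: mult.commute)
  then have "2 * of_int j \<le> real n" by simp
  then have up: "2 * j \<le> int n" by linarith
  have "real n * (pi - 3 * pi / real n) < real n * \<theta>"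
    using g n unfolding \<theta>_def by (intro mult_strict_left_mono) auto
  also have "real n * (pi - 3 * pi / real n) = (real n - 3) * pi"
    using n by (simp add: field_simps)
  finally have "(real n - 3) * pi < (2 * of_int j) * pi"
    unfolding j by (simp add: mult_ac)
  then have "real n - 3 < 2 * of_int j" by simp
  then have lo: "int n - 3 < 2 * j" by linarith
  have "2 * j = int n - 1"
    using up lo odd by presburger
  then have "2 * real_of_int j = real n - 1" by linarith
  then have "real n * \<theta> = (real n - 1) * pi"
    unfolding j by (simp add: mult_ac)
  then have th_eq: "\<theta> = pi - pi / real n"
    using n by (simp add: field_simps)
  \<comment> \<open>The axis is chosen so that a quarter turn about it sends \<open>y 0\<close> to \<open>w\<close>.\<close>
  define u where "u = y 0 \<times> w"
  have uv: "u \<times> y 0 = w"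
    unfolding u_def cross_skew[of "y 0 \<times> w" "y 0"] using w y_unit by (simp add: Lagrange)
  have "(norm u)\<^sup>2 = 1"
    using norm_cross_dot[of "y 0" w] by (simp add: u_def w y_unit)
  then have u: "norm u = 1"
    using norm_ge_zero[of u] by (auto simp: power2_eq_1_iff simp del: norm_ge_zero)
  have u0: "u \<bullet> y 0 = 0" by (simp add: u_def dot_cross_self)
  have "\<Gamma> i = mat_exp (((real i - 1) * (pi - pi / real n)) *\<^sub>R hat u) *v y 0" if "i \<in> {1..n}" for i
  proof -
    have "\<Gamma> i = y (i - 1)" using that by (auto simp: y_def)
    also have "\<dots> = cos ((real i - 1) * \<theta>) *\<^sub>R y 0 + sin ((real i - 1) * \<theta>) *\<^sub>R w"
      using that by (subst y_eq) (auto simp: of_nat_diff)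
    finally show ?thesis
      by (simp add: mat_exp_hat_apply[OF u u0] uv th_eq)
  qed
  moreover have "u \<in> S2" "y 0 \<in> S2"
    using u y_unit by (simp_all add: S2_def)
  ultimately show ?thesis
    unfolding M_o_def using \<Gamma> u0 by blast
qed

lemma M_o_orthonormal_frame:
  assumes "\<Gamma> \<in> M_o n"
  obtains v w where "norm v = 1" "norm w = 1" "v \<bullet> w = 0"
    "\<And>i. i \<in> {1..n} \<Longrightarrow> \<Gamma> i = cos ((real i - 1) * (pi - pi / real n)) *\<^sub>R v
       + sin ((real i - 1) * (pi - pi / real n)) *\<^sub>R w"
proof -
  obtain u v where uv: "norm u = 1" "norm v = 1" "u \<bullet> v = 0"
    and \<Gamma>: "\<And>i. i \<in> {1..n} \<Longrightarrow>
      \<Gamma> i = mat_exp (((real i - 1) * (pi - pi / real n)) *\<^sub>R hat u) *v v"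
    using assms by (auto simp: M_o_def S2_def)
  have "(norm (u \<times> v))\<^sup>2 = 1"
    using norm_cross_dot[of u v] by (simp add: uv)
  then have "norm (u \<times> v) = 1"
    using norm_ge_zero[of "u \<times> v"] by (auto simp: power2_eq_1_iff simp del: norm_ge_zero)
  then show ?thesis
    using uv \<Gamma> by (intro that[of v "u \<times> v"]) (simp_all add: mat_exp_hat_apply dot_cross_self)
qed

lemma inner_on_great_circle:
  fixes v w :: "'a::real_inner"
  assumes "norm v = 1" "norm w = 1" "v \<bullet> w = 0"
  shows "(cos a *\<^sub>R v + sin a *\<^sub>R w) \<bullet> (cos b *\<^sub>R v + sin b *\<^sub>R w) = cos (a - b)"
  using assms by (simp add: inner_add_left inner_add_right inner_commute[of w v] norm_eq_1 cos_diff)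

text \<open>For the closing edge from \<open>n\<close> back to 1 the angle is \<open>(n - 1) * \<theta>\<close> with
  \<open>n * \<theta> = (n - 1) * pi\<close>; this is an even multiple of \<open>pi\<close> because \<open>n\<close> is odd, so the last step has the
  same length as the others.\<close>

lemma M_o_edge_cos:
  assumes n: "n \<ge> 3" "odd n" and \<Gamma>: "\<Gamma> \<in> M_o n" and i: "i \<in> {1..n}"
  shows "edge_cos n \<Gamma> i = - cos (pi / real n)"
proof -
  define \<theta> where "\<theta> = pi - pi / real n"
  obtain v w where vw: "norm v = 1" "norm w = 1" "v \<bullet> w = 0"
    and G: "\<And>i. i \<in> {1..n} \<Longrightarrow>
      \<Gamma> i = cos ((real i - 1) * \<theta>) *\<^sub>R v + sin ((real i - 1) * \<theta>) *\<^sub>R w"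
    using M_o_orthonormal_frame[OF \<Gamma>] unfolding \<theta>_def by blast
  have "edge_cos n \<Gamma> i = cos ((real i - 1) * \<theta> - (real (next_idx n i) - 1) * \<theta>)"
    unfolding edge_cos_def G[OF i] G[OF next_idx_in[OF i]] by (rule inner_on_great_circle[OF vw])
  also have "\<dots> = cos \<theta>"
  proof (cases "i = n")
    case True
    obtain m where "n = 2 * m + 1" using n(2) by (elim oddE)
    then have "(real n - 1) * \<theta> = - \<theta> + 2 * real m * pi"
      by (simp add: \<theta>_def field_simps)
    also have "cos \<dots> = cos \<theta>"
      using cos_2npi[of m] sin_2npi[of m] by (simp add: cos_add cos_diff)
    finally show ?thesis using True by (simp add: next_idx_def)
  next
    case False
    then show ?thesis by (simp add: next_idx_def left_diff_distrib[symmetric])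
  qed
  finally show ?thesis by (simp add: \<theta>_def)
qed

lemma M_o_nonempty: "M_o n \<noteq> {}"
proof -
  define u v where "u = (axis 1 1 :: real^3)" and "v = (axis 2 1 :: real^3)"
  have uv: "norm u = 1" "norm v = 1" "u \<bullet> v = 0"
    by (auto simp: u_def v_def norm_axis_1 inner_axis_axis)
  define \<Gamma> where "\<Gamma> = (\<lambda>i\<in>{1..n}. mat_exp (((real i - 1) * (pi - pi / real n)) *\<^sub>R hat u) *v v)"
  have "(norm (u \<times> v))\<^sup>2 = 1"
    using norm_cross_dot[of u v] by (simp add: uv)
  then have nuv: "norm (u \<times> v) = 1"
    using norm_ge_zero[of "u \<times> v"] by (auto simp: power2_eq_1_iff simp del: norm_ge_zero)
  have "norm (mat_exp (t *\<^sub>R hat u) *v v) = 1" for t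
    using inner_on_great_circle[OF uv(2) nuv, of t t]
    by (simp add: mat_exp_hat_apply uv dot_cross_self norm_eq_1)
  then have "\<Gamma> \<in> S2_pow n"
    by (auto simp: \<Gamma>_def S2_pow_def S2_def)
  moreover have "u \<in> S2" "v \<in> S2"
    using uv by (simp_all add: S2_def)
  ultimately have "\<Gamma> \<in> M_o n"
    unfolding M_o_def using uv(3) by (auto simp: \<Gamma>_def)
  then show ?thesis by blast
qed

section \<open>The energy and its minimizers\<close>

definition energy :: "nat \<Rightarrow> config \<Rightarrow> real" where
  "energy n \<Gamma> = (\<Sum>i\<in>{1..n}. edge_cos n \<Gamma> i)"

lemma energy_M_o:
  assumes "n \<ge> 3" "odd n" "\<Gamma> \<in> M_o n"
  shows "energy n \<Gamma> = - real n * cos (pi / real n)"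
  unfolding energy_def using M_o_edge_cos[OF assms] by simp

lemma compact_S2_pow: "compact (S2_pow n)"
proof -
  define K where "K i = (if i \<in> {1..n} then S2 else {undefined})" for i
  have "compact (K i)" for i
    by (simp add: K_def S2_def)
  then have "compactin (product_topology (\<lambda>i. euclidean) UNIV) (Pi\<^sub>E UNIV K)"
    by (simp add: compactin_PiE)
  moreover have "S2_pow n = Pi\<^sub>E UNIV K"
    unfolding S2_pow_def K_def PiE_def Pi_def extensional_def
    by (rule set_eqI) (simp, metis)
  ultimately show ?thesis
    by (simp add: euclidean_product_topology)
qed

lemma continuous_on_edge_cos [continuous_intros]: "continuous_on A (\<lambda>\<Gamma>. edge_cos n \<Gamma> i)"
  unfolding edge_cos_def
  by (intro continuous_intros continuous_on_product_then_coordinatewise[OF continuous_on_id])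

lemma continuous_on_energy: "continuous_on A (energy n)"
  unfolding energy_def by (intro continuous_intros)

lemma inner_tangent_part:
  assumes "norm b = 1"
  shows "tangent_part b x \<bullet> tangent_part b y = x \<bullet> y - (b \<bullet> x) * (b \<bullet> y)"
  using assms by (simp add: tangent_part_def inner_diff_left inner_diff_right norm_eq_1 inner_commute)

lemma tangent_part_add: "tangent_part b (x + y) = tangent_part b x + tangent_part b y"
  by (simp add: tangent_part_def inner_add_right algebra_simps)

text \<open>The linear function \<open>x \<bullet> s\<close> is smallest on the sphere at \<open>- s / norm s\<close>. Comparing with that
  point gives \<open>norm s \<le> \<bar>b \<bullet> s\<bar>\<close>, the case of equality in the Cauchy-Schwarz inequality.\<close>

lemma tangent_part_eq_0_if_minimal:
  assumes b: "norm b = 1" and min: "\<And>x. norm x = 1 \<Longrightarrow> b \<bullet> s \<le> x \<bullet> s"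
  shows "tangent_part b s = 0"
proof (cases "s = 0")
  case False
  have "b \<bullet> s \<le> (- (s /\<^sub>R norm s)) \<bullet> s"
    by (rule min) (simp add: False)
  also have "\<dots> = - norm s"
    using False by (simp add: power2_norm_eq_inner[symmetric] power2_eq_square)
  finally have "norm s \<le> - (b \<bullet> s)" by simp
  then have "(norm s)\<^sup>2 \<le> (b \<bullet> s)\<^sup>2"
    using power_mono[of "norm s" "- (b \<bullet> s)" 2] by simp
  then have "tangent_part b s \<bullet> tangent_part b s \<le> 0"
    unfolding inner_tangent_part[OF b] by (simp add: power2_norm_eq_inner) (simp add: power2_eq_square)
  then show ?thesis by (metis inner_eq_zero_iff inner_ge_zero order_antisym)
qed (simp add: tangent_part_def)

text \<open>As a function of one agent alone the energy is affine. For \<open>n \<ge> 3\<close> the two edges at agent \<open>i\<close> are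
  distinct, which is why both neighbours contribute exactly once.\<close>

lemma energy_update:
  assumes n: "n \<ge> 3" and i: "i \<in> {1..n}"
  shows "energy n (\<Gamma>(i := x)) =
    energy n \<Gamma> + (x - \<Gamma> i) \<bullet> (\<Gamma> (prev_idx n i) + \<Gamma> (next_idx n i))"
proof -
  have "edge_cos n (\<Gamma>(i := x)) j = edge_cos n \<Gamma> j
      + (if j = i then (x - \<Gamma> i) \<bullet> \<Gamma> (next_idx n i) else 0)
      + (if j = prev_idx n i then (x - \<Gamma> i) \<bullet> \<Gamma> (prev_idx n i) else 0)" if "j \<in> {1..n}" for j
    using n i that
    by (auto simp: edge_cos_def next_idx_def prev_idx_def inner_diff_left inner_diff_right inner_commute
        split: if_splits)
  then have "energy n (\<Gamma>(i := x)) = (\<Sum>j\<in>{1..n}. edge_cos n \<Gamma> j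
      + (if j = i then (x - \<Gamma> i) \<bullet> \<Gamma> (next_idx n i) else 0)
      + (if j = prev_idx n i then (x - \<Gamma> i) \<bullet> \<Gamma> (prev_idx n i) else 0))"
    unfolding energy_def by (rule sum.cong[OF refl])
  also have "\<dots> = energy n \<Gamma> + (x - \<Gamma> i) \<bullet> \<Gamma> (next_idx n i) + (x - \<Gamma> i) \<bullet> \<Gamma> (prev_idx n i)"
    using i prev_idx_in[OF i] unfolding energy_def sum.distrib by (simp add: sum.delta)
  finally show ?thesis by (simp add: inner_add_right)
qed

lemma ring_defect_eq_0_if_energy_minimal:
  assumes n: "n \<ge> 3" and \<Gamma>: "\<Gamma> \<in> S2_pow n" and i: "i \<in> {1..n}"
    and min: "\<And>\<Gamma>'. \<Gamma>' \<in> S2_pow n \<Longrightarrow> energy n \<Gamma> \<le> energy n \<Gamma>'"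
  shows "ring_defect n \<Gamma> i = 0"
  unfolding ring_defect_def
proof (rule tangent_part_eq_0_if_minimal)
  show "norm (\<Gamma> i) = 1" by (rule S2_powD[OF \<Gamma> i])
  fix x :: "real ^ 3" assume "norm x = 1"
  then have "\<Gamma>(i := x) \<in> S2_pow n"
    using \<Gamma> i by (auto simp: S2_pow_def S2_def PiE_iff extensional_def)
  from min[OF this] show "\<Gamma> i \<bullet> (\<Gamma> (prev_idx n i) + \<Gamma> (next_idx n i))
      \<le> x \<bullet> (\<Gamma> (prev_idx n i) + \<Gamma> (next_idx n i))"
    by (simp add: energy_update[OF n i] inner_diff_left)
qed

lemma ring_constant:
  assumes "\<And>i. i \<in> {1..n} \<Longrightarrow> f (prev_idx n i) = f i" and "i \<in> {1..n}"
  shows "f i = f 1"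
proof -
  have "1 \<le> i" "i \<le> n" using assms(2) by auto
  then show ?thesis
  proof (induction i rule: nat_induct_at_least)
    case (Suc j)
    then show ?case using assms(1)[of "Suc j"] by (auto simp: prev_idx_def)
  qed simp
qed

text \<open>The tangential parts at \<open>\<Gamma> j\<close> of its two neighbours cancel, so they have the same norm; that
  norm is the sine of the angle between \<open>\<Gamma> j\<close> and the neighbour.\<close>

lemma edge_cos_square_constant:
  assumes \<Gamma>: "\<Gamma> \<in> S2_pow n" and defect: "\<And>i. i \<in> {1..n} \<Longrightarrow> ring_defect n \<Gamma> i = 0"
    and i: "i \<in> {1..n}"
  shows "(edge_cos n \<Gamma> i)\<^sup>2 = (edge_cos n \<Gamma> 1)\<^sup>2"
proof (rule ring_constant[of n "\<lambda>i. (edge_cos n \<Gamma> i)\<^sup>2", OF _ i])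
  fix j assume j: "j \<in> {1..n}"
  let ?T = "tangent_part (\<Gamma> j)"
  have "?T (\<Gamma> (prev_idx n j)) = - ?T (\<Gamma> (next_idx n j))"
    using defect[OF j] by (simp add: ring_defect_def tangent_part_add eq_neg_iff_add_eq_0)
  then have "?T (\<Gamma> (prev_idx n j)) \<bullet> ?T (\<Gamma> (prev_idx n j))
      = ?T (\<Gamma> (next_idx n j)) \<bullet> ?T (\<Gamma> (next_idx n j))"
    by simp
  then show "(edge_cos n \<Gamma> (prev_idx n j))\<^sup>2 = (edge_cos n \<Gamma> j)\<^sup>2"
    unfolding inner_tangent_part[OF S2_powD(1)[OF \<Gamma> j]] edge_cos_def next_prev_idx[OF j]
    using S2_powD(2)[OF \<Gamma> prev_idx_in[OF j]] S2_powD(2)[OF \<Gamma> next_idx_in[OF j]]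
    by (simp add: power2_eq_square inner_commute)
qed

lemma edge_cos_bounds:
  assumes "\<Gamma> \<in> S2_pow n" "i \<in> {1..n}"
  shows "- 1 \<le> edge_cos n \<Gamma> i" "edge_cos n \<Gamma> i \<le> 1"
  unfolding edge_cos_def
  using inner_unit_bounds[OF S2_powD(1)[OF assms] S2_powD(1)[OF assms(1) next_idx_in[OF assms(2)]]]
  by auto


lemma cos_ge_quadratic: "1 - x\<^sup>2 / 2 \<le> cos (x::real)"
proof -
  have "(sin (x / 2))\<^sup>2 \<le> (x / 2)\<^sup>2"
    using abs_sin_x_le_abs_x[of "x / 2"] abs_le_square_iff[of "sin (x / 2)" "x / 2"] by blast
  then show ?thesis
    using cos_double_sin[of "x / 2"] by (simp add: power_divide)
qed

text \<open>The left side bounds minus the energy of a configuration without defects that has at least one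
  acute edge; the right side is minus the energy on \<open>M_o n\<close>. So such a configuration cannot be minimal.\<close>

lemma n_minus_2_less_n_cos:
  assumes "n \<ge> 3"
  shows "real n - 2 < real n * cos (pi / real n)"
proof -
  have "pi * pi \<le> (32/10) * (32/10)"
    using pi_approx pi_gt_zero by (intro mult_mono) auto
  then have "pi\<^sup>2 < 4 * real n"
    using assms by (simp add: power2_eq_square)
  then have "real n - 2 < real n * (1 - (pi / real n)\<^sup>2 / 2)"
    using assms by (simp add: field_simps power2_eq_square)
  also have "\<dots> \<le> real n * cos (pi / real n)"
    by (intro mult_left_mono cos_ge_quadratic) simp
  finally show ?thesis .
qed

text \<open>At a minimizer all defects vanish, so all edge cosines are \<open>c\<close> or \<open>- c\<close> for one \<open>c\<close>. A positive
  one among them would make the energy at least \<open>- (n - 2)\<close>, more than its value on \<open>M_o n\<close>. So all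
  edges are equal, and comparison with \<open>M_o n\<close> once more shows that they are long enough for the
  classification of critical configurations to apply.\<close>

lemma energy_minimizer_in_M_o:
  assumes n: "n \<ge> 3" and odd: "odd n" and \<Gamma>: "\<Gamma> \<in> S2_pow n"
    and min: "\<And>\<Gamma>'. \<Gamma>' \<in> S2_pow n \<Longrightarrow> energy n \<Gamma> \<le> energy n \<Gamma>'"
  shows "\<Gamma> \<in> M_o n"
proof -
  note defect = ring_defect_eq_0_if_energy_minimal[OF n \<Gamma> _ min]
  define c where "c = \<bar>edge_cos n \<Gamma> 1\<bar>"
  have abs_c: "\<bar>edge_cos n \<Gamma> i\<bar> = c" if "i \<in> {1..n}" for i
    using edge_cos_square_constant[OF \<Gamma> defect that] by (simp add: c_def power2_eq_iff abs_eq_iff)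
  have "c \<le> 1"
    using edge_cos_bounds[OF \<Gamma>, of 1] n by (simp add: c_def abs_le_iff)
  obtain \<Gamma>' where "\<Gamma>' \<in> M_o n" using M_o_nonempty by blast
  then have "energy n \<Gamma> \<le> - real n * cos (pi / real n)"
    using min[of \<Gamma>'] energy_M_o[OF n odd] by (simp add: M_o_def)
  then have low: "real n * cos (pi / real n) \<le> - energy n \<Gamma>" by simp
  have edges: "edge_cos n \<Gamma> i = - c" if i: "i \<in> {1..n}" for i
  proof (rule ccontr)
    assume "edge_cos n \<Gamma> i \<noteq> - c"
    then have pos: "- edge_cos n \<Gamma> i = - c" using abs_c[OF i] by linarith
    have "- energy n \<Gamma> = - edge_cos n \<Gamma> i + (\<Sum>j\<in>{1..n} - {i}. - edge_cos n \<Gamma> j)"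
      unfolding energy_def sum_negf[symmetric] by (rule sum.remove) (use i in auto)
    also have "(\<Sum>j\<in>{1..n} - {i}. - edge_cos n \<Gamma> j) \<le> (\<Sum>j\<in>{1..n} - {i}. c)"
      by (rule sum_mono) (use abs_c in \<open>fastforce\<close>)
    also have "\<dots> = (real n - 1) * c"
      using i by (simp add: of_nat_diff)
    finally have "- energy n \<Gamma> \<le> (real n - 2) * c" by (simp add: pos algebra_simps)
    also have "\<dots> \<le> real n - 2"
      using \<open>c \<le> 1\<close> n mult_left_mono[of c 1 "real n - 2"] by simp
    finally show False using low n_minus_2_less_n_cos[OF n] by linarith
  qed
  have "energy n \<Gamma> = real n * (- c)"
    unfolding energy_def using edges by simp
  then have "real n * cos (pi / real n) \<le> real n * c" using low by simp
  then have cge: "cos (pi / real n) \<le> c" using n by simp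
  have "pi - pi / real n = arccos (cos (pi - pi / real n))"
    using n by (intro arccos_cos[symmetric]) (auto simp: field_simps)
  also have "\<dots> \<le> arccos (- c)"
    using cge \<open>c \<le> 1\<close> by (intro arccos_le_arccos) auto
  finally have "pi - 3 * pi / real n < arccos (- c)"
    using n by (simp add: field_simps) (smt (verit) pi_gt_zero)
  then show ?thesis
    using critical_equal_edges_in_M_o[OF n odd \<Gamma> defect edges] by blast
qed

text \<open>Compactness provides a minimizer, and every minimizer lies in \<open>M_o n\<close>, where the energy is known.\<close>

lemma energy_minimum:
  assumes n: "n \<ge> 3" and odd: "odd n" and \<Gamma>: "\<Gamma> \<in> S2_pow n"
  shows "- real n * cos (pi / real n) \<le> energy n \<Gamma>"
    and "energy n \<Gamma> = - real n * cos (pi / real n) \<longleftrightarrow> \<Gamma> \<in> M_o n"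
proof -
  obtain \<Gamma>0 where \<Gamma>0: "\<Gamma>0 \<in> S2_pow n"
    and min: "\<And>\<Gamma>'. \<Gamma>' \<in> S2_pow n \<Longrightarrow> energy n \<Gamma>0 \<le> energy n \<Gamma>'"
    using continuous_attains_inf[OF compact_S2_pow[of n] _ continuous_on_energy] \<Gamma> by blast
  have val: "energy n \<Gamma>0 = - real n * cos (pi / real n)"
    by (rule energy_M_o[OF n odd energy_minimizer_in_M_o[OF n odd \<Gamma>0 min]])
  show "- real n * cos (pi / real n) \<le> energy n \<Gamma>"
    using min[OF \<Gamma>] val by simp
  show "energy n \<Gamma> = - real n * cos (pi / real n) \<longleftrightarrow> \<Gamma> \<in> M_o n"
  proof
    assume "energy n \<Gamma> = - real n * cos (pi / real n)"
    then show "\<Gamma> \<in> M_o n"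
      using energy_minimizer_in_M_o[OF n odd \<Gamma>] min val by simp
  qed (rule energy_M_o[OF n odd])
qed

section \<open>Scalar functions on a half-line\<close>

text \<open>The smallest of finitely many functions cannot fall below a positive initial bound if the
  derivative of whichever function is smallest is nonnegative. Since that derivative may vanish, the
  level \<open>m\<close> is replaced by the slowly sinking level \<open>m - \<eta> * (1 + t)\<close>: where a function first touches
  it, the height above the level would have a positive derivative, yet it comes down to 0 from positive values. Finally
  \<open>\<eta>\<close> tends to 0.\<close>

lemma minimum_barrier:
  fixes f f' :: "'i \<Rightarrow> real \<Rightarrow> real"
  assumes fin: "finite I"
    and deriv: "\<And>i t. \<lbrakk>i \<in> I; 0 \<le> t\<rbrakk> \<Longrightarrow> (f i has_real_derivative f' i t) (at t within {0..})"
    and push: "\<And>i t. \<lbrakk>i \<in> I; 0 \<le> t; 0 < f i t; \<And>j. j \<in> I \<Longrightarrow> f i t \<le> f j t\<rbrakk> \<Longrightarrow> 0 \<le> f' i t"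
    and init: "\<And>i. i \<in> I \<Longrightarrow> m \<le> f i 0" and m: "0 < m"
    and k: "k \<in> I" and T: "0 \<le> T"
  shows "m \<le> f k T"
proof (rule field_le_epsilon)
  fix e :: real assume e: "0 < e"
  \<comment> \<open>Small enough for the level not to fall below \<open>m / 2 > 0\<close> up to time \<open>T\<close>.\<close>
  define \<eta> where "\<eta> = min e (m / 2) / (1 + T)"
  have \<eta>: "0 < \<eta>" using e m T by (simp add: \<eta>_def)
  have \<eta>T: "\<eta> * (1 + T) = min e (m / 2)" using T by (simp add: \<eta>_def)
  define h where "h i t = f i t - (m - \<eta> * (1 + t))" for i t
  have hderiv: "(h i has_real_derivative f' i t + \<eta>) (at t within {0..})" if "i \<in> I" "0 \<le> t" for i t
    unfolding h_def by (auto intro!: derivative_eq_intros deriv that)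
  have hcont: "continuous_on {0..} (h i)" if "i \<in> I" for i
    using hderiv[OF that] by (intro DERIV_continuous_on) auto
  have h0: "0 < h i 0" if "i \<in> I" for i
    using init[OF that] \<eta> by (simp add: h_def)
  define B where "B = (\<Union>i\<in>I. {t \<in> {0..T}. h i t \<le> 0})"
  have "B = {}"
  proof (rule ccontr)
    assume "B \<noteq> {}"
    have "closed B"
      unfolding B_def
    proof (intro closed_UN fin ballI)
      fix i assume i: "i \<in> I"
      have "closed ({0..T} \<inter> h i -` {..0})"
        by (intro continuous_closed_preimage continuous_on_subset[OF hcont[OF i]]) auto
      moreover have "{t \<in> {0..T}. h i t \<le> 0} = {0..T} \<inter> h i -` {..0}" by auto
      ultimately show "closed {t \<in> {0..T}. h i t \<le> 0}" by simp
    qed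
    moreover have bdd: "bdd_below B"
      by (rule bdd_belowI[of _ 0]) (auto simp: B_def)
    ultimately have "Inf B \<in> B"
      using \<open>B \<noteq> {}\<close> by (intro closed_contains_Inf)
    \<comment> \<open>The first time at which some function is on or below the sinking level.\<close>
    define s where "s = Inf B"
    have first: "s \<le> t" if "t \<in> B" for t
      unfolding s_def by (rule cInf_lower[OF that bdd])
    obtain i where i: "i \<in> I" "0 \<le> s" "s \<le> T" "h i s \<le> 0"
      using \<open>Inf B \<in> B\<close> by (auto simp: B_def s_def)
    have touch: "h j s = 0" if j: "j \<in> I" "h j s \<le> 0" for j
    proof -
      have "continuous_on {0..s} (h j)"
        by (rule continuous_on_subset[OF hcont[OF j(1)]]) auto
      then obtain x where "0 \<le> x" "x \<le> s" "h j x = 0"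
        using IVT2'[of "h j" s 0 0] h0[OF j(1)] j(2) i(2) by auto
      moreover from this have "x \<in> B" using j(1) i(3) by (auto simp: B_def intro!: bexI[of _ j])
      ultimately show ?thesis using first[of x] by simp
    qed
    have "\<eta> * (1 + s) \<le> \<eta> * (1 + T)" using i(3) \<eta> by (intro mult_left_mono) auto
    then have "\<eta> * (1 + s) \<le> m / 2" using \<eta>T by linarith
    then have pos: "0 < f i s"
      using touch[OF i(1,4)] m by (simp add: h_def)
    have least: "f i s \<le> f j s" if "j \<in> I" for j
      using touch[OF i(1,4)] touch[OF that] by (cases "h j s \<le> 0") (auto simp: h_def)
    have "0 < f' i s + \<eta>"
      using push[OF i(1,2) pos least] \<eta> by simp
    from has_real_derivative_pos_inc_left[OF hderiv[OF i(1,2)] this]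
    obtain d where d: "0 < d" "\<And>r. \<lbrakk>0 < r; s - r \<in> {0..}; r < d\<rbrakk> \<Longrightarrow> h i (s - r) < h i s"
      by blast
    have "s \<noteq> 0" using h0[OF i(1)] i(4) by auto
    then have "0 < s" using i(2) by simp
    define r where "r = min (d / 2) s"
    have r: "0 < r" "r \<le> s" "r < d" using d(1) \<open>0 < s\<close> by (auto simp: r_def)
    then have "h i (s - r) < h i s" by (intro d(2)) auto
    then have "s - r \<in> B" using r i by (auto simp: B_def intro!: bexI[of _ i])
    then show False using first[of "s - r"] r by simp
  qed
  then have "0 < h k T" using k T by (force simp: B_def)
  then show "m \<le> f k T + e" using \<eta>T by (simp add: h_def)
qed

text \<open>Barbalat's lemma. If \<open>d\<close> were not small at a late time, uniform continuity would keep it away from 0 on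
  an interval of fixed length, and \<open>u\<close> would change there by a fixed amount.\<close>

lemma barbalat:
  fixes u d :: "real \<Rightarrow> real"
  assumes deriv: "\<And>t. 0 \<le> t \<Longrightarrow> (u has_real_derivative d t) (at t within {0..})"
    and uc: "uniformly_continuous_on {0..} d"
    and lim: "(u \<longlongrightarrow> l) at_top"
  shows "(d \<longlongrightarrow> 0) at_top"
proof (rule tendstoI)
  fix e :: real assume e: "0 < e"
  obtain \<delta> where \<delta>: "0 < \<delta>" and close: "\<And>s t. \<lbrakk>0 \<le> s; 0 \<le> t; dist s t < \<delta>\<rbrakk> \<Longrightarrow> dist (d s) (d t) < e / 2"
    using uc[unfolded uniformly_continuous_on_def, rule_format, of "e / 2"] e by force
  have "eventually (\<lambda>t. dist (u t) l < e * \<delta> / 8) at_top"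
    using lim e \<delta> by (intro tendstoD) auto
  then obtain T where T: "\<And>t. T \<le> t \<Longrightarrow> dist (u t) l < e * \<delta> / 8"
    by (auto simp: eventually_at_top_linorder)
  have "dist (d t) 0 < e" if t: "max 0 T \<le> t" for t
  proof -
    have "\<exists>x\<in>{t<..<t + \<delta> / 2}. u (t + \<delta> / 2) - u t = (*) (d x) (t + \<delta> / 2 - t)"
    proof (rule mvt_simple)
      show "t < t + \<delta> / 2" using \<delta> by simp
      fix x assume "t \<le> x" "x \<le> t + \<delta> / 2"
      then show "(u has_derivative (*) (d x)) (at x within {t..t + \<delta> / 2})"
        using deriv[of x] t unfolding has_field_derivative_def
        by (auto elim!: has_derivative_subset)
    qed
    then obtain x where x: "t < x" "x < t + \<delta> / 2" "u (t + \<delta> / 2) - u t = d x * (\<delta> / 2)"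
      by auto
    have "\<bar>d x * (\<delta> / 2)\<bar> < e * \<delta> / 4"
      using T[of t, unfolded dist_real_def] T[of "t + \<delta> / 2", unfolded dist_real_def] t \<delta>
      unfolding x(3)[symmetric] by linarith
    then have "\<bar>d x\<bar> < e / 2" using \<delta> by (simp add: abs_mult field_simps)
    moreover have "dist (d x) (d t) < e / 2"
      using x t by (intro close) (auto simp: dist_real_def)
    ultimately show ?thesis unfolding dist_real_def by linarith
  qed
  then show "eventually (\<lambda>t. dist (d t) 0 < e) at_top"
    unfolding eventually_at_top_linorder by blast
qed

lemma nonincreasing_of_derivative_nonpos:
  fixes u d :: "real \<Rightarrow> real"
  assumes deriv: "\<And>t. 0 \<le> t \<Longrightarrow> (u has_real_derivative d t) (at t within {0..})"
    and neg: "\<And>t. 0 \<le> t \<Longrightarrow> d t \<le> 0"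
    and st: "0 \<le> s" "s \<le> t"
  shows "u t \<le> u s"
proof (cases "s = t")
  case False
  have "\<exists>x\<in>{s<..<t}. u t - u s = (*) (d x) (t - s)"
  proof (rule mvt_simple)
    show "s < t" using False st by simp
    fix x assume "s \<le> x" "x \<le> t"
    then show "(u has_derivative (*) (d x)) (at x within {s..t})"
      using deriv[of x] st unfolding has_field_derivative_def
      by (auto elim!: has_derivative_subset)
  qed
  then obtain x where "s < x" "u t - u s = d x * (t - s)" by auto
  then show ?thesis
    using neg[of x] st mult_nonpos_nonneg[of "d x" "t - s"] by auto
qed simp

lemma nonincreasing_bounded_below_converges:
  fixes u :: "real \<Rightarrow> real"
  assumes mono: "\<And>s t. \<lbrakk>0 \<le> s; s \<le> t\<rbrakk> \<Longrightarrow> u t \<le> u s"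
    and low: "\<And>t. 0 \<le> t \<Longrightarrow> b \<le> u t"
  obtains l where "(u \<longlongrightarrow> l) at_top"
proof -
  have bdd: "bdd_below (u ` {0..})"
    using low by (intro bdd_belowI[of _ b]) auto
  have "(u \<longlongrightarrow> Inf (u ` {0..})) at_top"
  proof (rule decreasing_tendsto)
    show "eventually (\<lambda>t. Inf (u ` {0..}) \<le> u t) at_top"
      using bdd by (intro eventually_at_top_linorderI[of 0] cInf_lower) auto
    fix x assume "Inf (u ` {0..}) < x"
    then obtain s where "0 \<le> s" "u s < x"
      using cInf_less_iff[OF _ bdd] by auto
    then show "eventually (\<lambda>t. u t < x) at_top"
      using mono by (intro eventually_at_top_linorderI[of s]) (meson le_less_trans)
  qed
  then show ?thesis by (rule that)
qed

section \<open>Decay of the energy along trajectories\<close>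

text \<open>With \<open>\<phi>\<close> the angle at \<open>\<Gamma> i\<close> between the arcs to its two neighbours, this is the product of
  \<open>cos \<phi>\<close> with the sines of the lengths of these arcs.\<close>

definition bend :: "nat \<Rightarrow> config \<Rightarrow> nat \<Rightarrow> real" where
  "bend n \<Gamma> i = tangent_part (\<Gamma> i) (\<Gamma> (prev_idx n i)) \<bullet> tangent_part (\<Gamma> i) (\<Gamma> (next_idx n i))"

definition dissipation :: "nat \<Rightarrow> config \<Rightarrow> real" where
  "dissipation n \<Gamma> = (\<Sum>i\<in>{1..n}. ring_defect n \<Gamma> i \<bullet> ring_defect n \<Gamma> i)"

definition edge_rate :: "nat \<Rightarrow> (config \<Rightarrow> config) \<Rightarrow> config \<Rightarrow> nat \<Rightarrow> real" where
  "edge_rate n F \<Gamma> i = F \<Gamma> i \<bullet> \<Gamma> (next_idx n i) + \<Gamma> i \<bullet> F \<Gamma> (next_idx n i)"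

lemma trajectoryD:
  assumes "trajectory n F \<Gamma>" "0 \<le> t"
  shows "\<Gamma> t \<in> S2_pow n"
    and "i \<in> {1..n} \<Longrightarrow> ((\<lambda>s. \<Gamma> s i) has_vector_derivative F (\<Gamma> t) i) (at t within {0..})"
  using assms by (auto simp: trajectory_def)

lemma edge_cos_derivative:
  assumes tr: "trajectory n F \<Gamma>" and t: "0 \<le> t" and i: "i \<in> {1..n}"
  shows "((\<lambda>s. edge_cos n (\<Gamma> s) i) has_real_derivative edge_rate n F (\<Gamma> t) i) (at t within {0..})"
  unfolding edge_cos_def edge_rate_def has_real_derivative_iff_has_vector_derivative
  using bounded_bilinear.has_vector_derivative[OF bounded_bilinear_inner
      trajectoryD(2)[OF tr t i] trajectoryD(2)[OF tr t next_idx_in[OF i]]]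
  by (simp add: add.commute)

lemma closed_loop_eq_tangent_part:
  assumes "norm (\<Gamma> i) = 1"
  shows "closed_loop N \<Gamma> i = - tangent_part (\<Gamma> i) (\<Sum>j\<in>N i. \<Gamma> j)"
  using assms by (simp add: closed_loop_def tangent_part_def Lagrange norm_eq_1)

text \<open>Projection to the tangent space at \<open>b\<close> is self-adjoint and idempotent.\<close>

lemma tangent_part_inner_swap:
  assumes "norm b = 1"
  shows "tangent_part b x \<bullet> y = tangent_part b y \<bullet> tangent_part b x"
  unfolding inner_tangent_part[OF assms] by (simp add: tangent_part_def algebra_simps inner_commute)

lemma tangent_part_edge:
  assumes \<Gamma>: "\<Gamma> \<in> S2_pow n" and i: "i \<in> {1..n}"
  defines "T \<equiv> tangent_part (\<Gamma> i)"
  shows "T (\<Gamma> (next_idx n i)) \<bullet> T (\<Gamma> (next_idx n i)) = 1 - (edge_cos n \<Gamma> i)\<^sup>2"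
    and "T (\<Gamma> (prev_idx n i)) \<bullet> T (\<Gamma> (prev_idx n i)) = 1 - (edge_cos n \<Gamma> (prev_idx n i))\<^sup>2"
  unfolding T_def inner_tangent_part[OF S2_powD(1)[OF \<Gamma> i]] edge_cos_def next_prev_idx[OF i]
  using S2_powD(2)[OF \<Gamma> prev_idx_in[OF i]] S2_powD(2)[OF \<Gamma> next_idx_in[OF i]]
  by (simp_all add: power2_eq_square inner_commute)

lemma ring_defect_inner_self:
  assumes \<Gamma>: "\<Gamma> \<in> S2_pow n" and i: "i \<in> {1..n}"
  shows "ring_defect n \<Gamma> i \<bullet> ring_defect n \<Gamma> i =
    (1 - (edge_cos n \<Gamma> (prev_idx n i))\<^sup>2) + (1 - (edge_cos n \<Gamma> i)\<^sup>2) + 2 * bend n \<Gamma> i"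
  unfolding ring_defect_def tangent_part_add inner_add_left inner_add_right tangent_part_edge[OF assms]
  by (simp add: bend_def inner_commute)

text \<open>The agent \<open>i\<close> at the tail of the edge moves straight away from the head, which gives the first
  summand; the motion of the head away from its own successor gives the bend.\<close>

lemma edge_rate_directed:
  assumes \<Gamma>: "\<Gamma> \<in> S2_pow n" and i: "i \<in> {1..n}"
  shows "edge_rate n (closed_loop (directed_ring n)) \<Gamma> i =
    - ((1 - (edge_cos n \<Gamma> i)\<^sup>2) + bend n \<Gamma> (next_idx n i))"
proof -
  let ?k = "next_idx n i"
  note k = next_idx_in[OF i]
  have "edge_rate n (closed_loop (directed_ring n)) \<Gamma> i =
      - (tangent_part (\<Gamma> i) (\<Gamma> ?k) \<bullet> \<Gamma> ?k)
      - (tangent_part (\<Gamma> ?k) (\<Gamma> (next_idx n ?k)) \<bullet> \<Gamma> i)"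
    using S2_powD(1)[OF \<Gamma> i] S2_powD(1)[OF \<Gamma> k]
    by (simp add: edge_rate_def closed_loop_eq_tangent_part directed_ring_def inner_commute[of "\<Gamma> i"])
  also have "tangent_part (\<Gamma> i) (\<Gamma> ?k) \<bullet> \<Gamma> ?k = 1 - (edge_cos n \<Gamma> i)\<^sup>2"
    unfolding tangent_part_inner_swap[OF S2_powD(1)[OF \<Gamma> i], of _ "\<Gamma> ?k"]
    by (rule tangent_part_edge(1)[OF \<Gamma> i])
  also have "tangent_part (\<Gamma> ?k) (\<Gamma> (next_idx n ?k)) \<bullet> \<Gamma> i = bend n \<Gamma> ?k"
    unfolding tangent_part_inner_swap[OF S2_powD(1)[OF \<Gamma> k], of _ "\<Gamma> i"]
    by (simp add: bend_def prev_next_idx[OF i])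
  finally show ?thesis by simp
qed

text \<open>Each endpoint is pushed away from the other one, which gives a squared sine, and from its neighbour
  outside the edge, which gives a bend.\<close>

lemma edge_rate_undirected:
  assumes n: "n \<ge> 3" and \<Gamma>: "\<Gamma> \<in> S2_pow n" and i: "i \<in> {1..n}"
  shows "edge_rate n (closed_loop (undirected_ring n)) \<Gamma> i =
    - ((1 - (edge_cos n \<Gamma> i)\<^sup>2) + bend n \<Gamma> (next_idx n i))
    - ((1 - (edge_cos n \<Gamma> i)\<^sup>2) + bend n \<Gamma> i)"
proof -
  have sum_N: "(\<Sum>j\<in>undirected_ring n k. \<Gamma> j) = \<Gamma> (prev_idx n k) + \<Gamma> (next_idx n k)"
    if "k \<in> {1..n}" for k
    unfolding undirected_ring_def using n that
    by (subst sum.insert) (auto simp: next_idx_def prev_idx_def split: if_splits)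
  let ?k = "next_idx n i"
  note k = next_idx_in[OF i]
  have "edge_rate n (closed_loop (undirected_ring n)) \<Gamma> i =
      - (tangent_part (\<Gamma> i) (\<Gamma> (prev_idx n i)) \<bullet> \<Gamma> ?k + tangent_part (\<Gamma> i) (\<Gamma> ?k) \<bullet> \<Gamma> ?k)
      - (tangent_part (\<Gamma> ?k) (\<Gamma> i) \<bullet> \<Gamma> i + tangent_part (\<Gamma> ?k) (\<Gamma> (next_idx n ?k)) \<bullet> \<Gamma> i)"
    using S2_powD(1)[OF \<Gamma> i] S2_powD(1)[OF \<Gamma> k]
    by (simp add: edge_rate_def closed_loop_eq_tangent_part sum_N[OF i] sum_N[OF k] tangent_part_add
        inner_add_left prev_next_idx[OF i] inner_commute[of "\<Gamma> i"] inner_diff_left)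
  also have "tangent_part (\<Gamma> i) (\<Gamma> (prev_idx n i)) \<bullet> \<Gamma> ?k = bend n \<Gamma> i"
    unfolding tangent_part_inner_swap[OF S2_powD(1)[OF \<Gamma> i], of _ "\<Gamma> ?k"]
    by (simp add: bend_def inner_commute)
  also have "tangent_part (\<Gamma> i) (\<Gamma> ?k) \<bullet> \<Gamma> ?k = 1 - (edge_cos n \<Gamma> i)\<^sup>2"
    unfolding tangent_part_inner_swap[OF S2_powD(1)[OF \<Gamma> i], of _ "\<Gamma> ?k"]
    by (rule tangent_part_edge(1)[OF \<Gamma> i])
  also have "tangent_part (\<Gamma> ?k) (\<Gamma> i) \<bullet> \<Gamma> i = 1 - (edge_cos n \<Gamma> i)\<^sup>2"
    unfolding tangent_part_inner_swap[OF S2_powD(1)[OF \<Gamma> k], of _ "\<Gamma> i"]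
    using tangent_part_edge(2)[OF \<Gamma> k] by (simp add: prev_next_idx[OF i])
  also have "tangent_part (\<Gamma> ?k) (\<Gamma> (next_idx n ?k)) \<bullet> \<Gamma> i = bend n \<Gamma> ?k"
    unfolding tangent_part_inner_swap[OF S2_powD(1)[OF \<Gamma> k], of _ "\<Gamma> i"]
    by (simp add: bend_def prev_next_idx[OF i])
  finally show ?thesis by simp
qed

text \<open>Among obtuse edges the one with the largest cosine is the shortest and has the largest sine.
  A nonnegative squared defect bounds the bend from below by minus the mean of the squared sines of the two
  adjacent edges, hence by minus the squared sine of the shortest edge.\<close>

lemma edge_rate_nonpos_at_shortest_edge:
  assumes n: "n \<ge> 3" and N: "N = undirected_ring n \<or> N = directed_ring n"
    and \<Gamma>: "\<Gamma> \<in> S2_pow n" and i: "i \<in> {1..n}"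
    and neg: "edge_cos n \<Gamma> i < 0"
    and max: "\<And>j. j \<in> {1..n} \<Longrightarrow> edge_cos n \<Gamma> j \<le> edge_cos n \<Gamma> i"
  shows "edge_rate n (closed_loop N) \<Gamma> i \<le> 0"
proof -
  have sq: "(edge_cos n \<Gamma> i)\<^sup>2 \<le> (edge_cos n \<Gamma> j)\<^sup>2" if "j \<in> {1..n}" for j
    using max[OF that] neg by (simp add: abs_le_square_iff[symmetric])
  have bend_ge: "0 \<le> (1 - (edge_cos n \<Gamma> i)\<^sup>2) + bend n \<Gamma> k" if k: "k \<in> {1..n}" for k
  proof -
    have "0 \<le> ring_defect n \<Gamma> k \<bullet> ring_defect n \<Gamma> k" by simp
    then show ?thesis
      unfolding ring_defect_inner_self[OF \<Gamma> k] using sq[OF k] sq[OF prev_idx_in[OF k]] by linarith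
  qed
  show ?thesis
    using N bend_ge[OF i] bend_ge[OF next_idx_in[OF i]]
    by (auto simp: edge_rate_directed[OF \<Gamma> i] edge_rate_undirected[OF n \<Gamma> i])
qed

text \<open>The square of a defect contains twice the bend, and each edge occurs in the defects of both of its
  endpoints; hence the common factor 2.\<close>

lemma dissipation_eq:
  assumes \<Gamma>: "\<Gamma> \<in> S2_pow n"
  shows "dissipation n \<Gamma> = 2 * (\<Sum>i\<in>{1..n}. (1 - (edge_cos n \<Gamma> i)\<^sup>2) + bend n \<Gamma> i)"
proof -
  have "dissipation n \<Gamma> = (\<Sum>i\<in>{1..n}. (1 - (edge_cos n \<Gamma> (prev_idx n i))\<^sup>2)
      + (1 - (edge_cos n \<Gamma> i)\<^sup>2) + 2 * bend n \<Gamma> i)"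
    unfolding dissipation_def by (rule sum.cong) (simp_all add: ring_defect_inner_self[OF \<Gamma>])
  also have "\<dots> = 2 * (\<Sum>i\<in>{1..n}. 1 - (edge_cos n \<Gamma> i)\<^sup>2) + 2 * (\<Sum>i\<in>{1..n}. bend n \<Gamma> i)"
    unfolding sum.distrib sum_prev_idx[of "\<lambda>i. 1 - (edge_cos n \<Gamma> i)\<^sup>2"] by (simp add: sum_distrib_left)
  finally show ?thesis by (simp add: sum.distrib)
qed

text \<open>Summed over the ring, the shift of indices in the bends disappears and the rates of the edge cosines
  add up to a negative multiple of the dissipation: \<open>\<kappa> = 1\<close> for the undirected ring, whose flow
  is the gradient flow of the energy, and \<open>\<kappa> = 1 / 2\<close> for the directed one, whose flow is a different
  one.\<close>

lemma sum_edge_rate: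
  assumes n: "n \<ge> 3" and N: "N = undirected_ring n \<or> N = directed_ring n"
  obtains \<kappa> :: real where "0 < \<kappa>"
    "\<And>\<Gamma>. \<Gamma> \<in> S2_pow n \<Longrightarrow>
       (\<Sum>i\<in>{1..n}. edge_rate n (closed_loop N) \<Gamma> i) = - \<kappa> * dissipation n \<Gamma>"
proof -
  have next_bend: "(\<Sum>i\<in>{1..n}. (1 - (edge_cos n \<Gamma> i)\<^sup>2) + bend n \<Gamma> (next_idx n i))
      = dissipation n \<Gamma> / 2" if "\<Gamma> \<in> S2_pow n" for \<Gamma>
    unfolding dissipation_eq[OF that] sum.distrib sum_next_idx[of "bend n \<Gamma>"] by simp
  from N show ?thesis
  proof
    assume N: "N = undirected_ring n"
    show ?thesis
    proof (rule that[of 1])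
      fix \<Gamma> assume \<Gamma>: "\<Gamma> \<in> S2_pow n"
      have "(\<Sum>i\<in>{1..n}. edge_rate n (closed_loop N) \<Gamma> i) =
          (\<Sum>i\<in>{1..n}. - ((1 - (edge_cos n \<Gamma> i)\<^sup>2) + bend n \<Gamma> (next_idx n i))
            - ((1 - (edge_cos n \<Gamma> i)\<^sup>2) + bend n \<Gamma> i))"
        unfolding N by (rule sum.cong) (simp_all add: edge_rate_undirected[OF n \<Gamma>])
      also have "\<dots> = - 1 * dissipation n \<Gamma>"
        unfolding sum_subtractf sum_negf next_bend[OF \<Gamma>] using dissipation_eq[OF \<Gamma>] by simp
      finally show "(\<Sum>i\<in>{1..n}. edge_rate n (closed_loop N) \<Gamma> i) = - 1 * dissipation n \<Gamma>" .
    qed simp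
  next
    assume N: "N = directed_ring n"
    show ?thesis
    proof (rule that[of "1 / 2"])
      fix \<Gamma> assume \<Gamma>: "\<Gamma> \<in> S2_pow n"
      have "(\<Sum>i\<in>{1..n}. edge_rate n (closed_loop N) \<Gamma> i) =
          (\<Sum>i\<in>{1..n}. - ((1 - (edge_cos n \<Gamma> i)\<^sup>2) + bend n \<Gamma> (next_idx n i)))"
        unfolding N by (rule sum.cong) (simp_all add: edge_rate_directed[OF \<Gamma>])
      also have "\<dots> = - (1 / 2) * dissipation n \<Gamma>"
        unfolding sum_negf next_bend[OF \<Gamma>] by simp
      finally show "(\<Sum>i\<in>{1..n}. edge_rate n (closed_loop N) \<Gamma> i) = - (1 / 2) * dissipation n \<Gamma>" .
    qed simp
  qed
qed

lemma dissipation_nonneg: "0 \<le> dissipation n \<Gamma>"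
  unfolding dissipation_def by (intro sum_nonneg) simp

lemma energy_derivative:
  assumes n: "n \<ge> 3" and N: "N = undirected_ring n \<or> N = directed_ring n"
  obtains \<kappa> :: real where "0 < \<kappa>"
    "\<And>\<Gamma> t. \<lbrakk>trajectory n (closed_loop N) \<Gamma>; 0 \<le> t\<rbrakk> \<Longrightarrow>
       ((\<lambda>s. energy n (\<Gamma> s)) has_real_derivative - \<kappa> * dissipation n (\<Gamma> t)) (at t within {0..})"
proof -
  obtain \<kappa> :: real where \<kappa>: "0 < \<kappa>" and rate: "\<And>\<Gamma>. \<Gamma> \<in> S2_pow n \<Longrightarrow>
       (\<Sum>i\<in>{1..n}. edge_rate n (closed_loop N) \<Gamma> i) = - \<kappa> * dissipation n \<Gamma>"
    using sum_edge_rate[OF assms] by blast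
  show ?thesis
  proof (rule that[OF \<kappa>])
    fix \<Gamma> and t :: real assume tr: "trajectory n (closed_loop N) \<Gamma>" and t: "0 \<le> t"
    show "((\<lambda>s. energy n (\<Gamma> s)) has_real_derivative - \<kappa> * dissipation n (\<Gamma> t)) (at t within {0..})"
      unfolding energy_def rate[OF trajectoryD(1)[OF tr t], symmetric]
      by (intro DERIV_sum edge_cos_derivative[OF tr t])
  qed
qed

lemma norm_tangent_part_le:
  assumes "norm b = 1"
  shows "norm (tangent_part b v) \<le> norm v"
  unfolding norm_le inner_tangent_part[OF assms] by simp

lemma norm_closed_loop_le:
  assumes N: "N = undirected_ring n \<or> N = directed_ring n"
    and \<Gamma>: "\<Gamma> \<in> S2_pow n" and i: "i \<in> {1..n}"
  shows "norm (closed_loop N \<Gamma> i) \<le> 2"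
proof -
  have sub: "N i \<subseteq> {1..n}" and card: "card (N i) \<le> 2"
    using N next_idx_in[OF i] prev_idx_in[OF i]
    by (auto simp: undirected_ring_def directed_ring_def card_insert_if)
  have "norm (closed_loop N \<Gamma> i) \<le> norm (\<Sum>j\<in>N i. \<Gamma> j)"
    using norm_tangent_part_le[OF S2_powD(1)[OF \<Gamma> i]]
    by (simp add: closed_loop_eq_tangent_part S2_powD(1)[OF \<Gamma> i])
  also have "\<dots> \<le> (\<Sum>j\<in>N i. norm (\<Gamma> j))"
    by (rule norm_sum)
  also have "\<dots> = (\<Sum>j\<in>N i. 1)"
    using sub S2_powD(1)[OF \<Gamma>] by (intro sum.cong) auto
  also have "\<dots> \<le> 2" using card by simp
  finally show ?thesis .
qed

lemma trajectory_lipschitz: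
  assumes N: "N = undirected_ring n \<or> N = directed_ring n"
    and tr: "trajectory n (closed_loop N) \<Gamma>" and i: "i \<in> {1..n}"
  shows "2-lipschitz_on {0..} (\<lambda>t. \<Gamma> t i)"
proof (rule bounded_derivative_imp_lipschitz)
  fix t :: real assume "t \<in> {0..}"
  then have t: "0 \<le> t" by simp
  show "((\<lambda>t. \<Gamma> t i) has_derivative (\<lambda>h. h *\<^sub>R closed_loop N (\<Gamma> t) i)) (at t within {0..})"
    using trajectoryD(2)[OF tr t i] by (simp add: has_vector_derivative_def)
  show "onorm (\<lambda>h. h *\<^sub>R closed_loop N (\<Gamma> t) i) \<le> 2"
  proof (rule onorm_le)
    fix h :: real
    show "norm (h *\<^sub>R closed_loop N (\<Gamma> t) i) \<le> 2 * norm h"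
      using norm_closed_loop_le[OF N trajectoryD(1)[OF tr t] i]
        mult_left_mono[of "norm (closed_loop N (\<Gamma> t) i)" 2 "\<bar>h\<bar>"] by (simp add: mult.commute)
  qed
qed auto

text \<open>Velocities are bounded, so agents move along Lipschitz curves, and each summand of the dissipation is
  a continuous function of three points of the compact sphere.\<close>

lemma uniformly_continuous_dissipation:
  assumes N: "N = undirected_ring n \<or> N = directed_ring n"
    and tr: "trajectory n (closed_loop N) \<Gamma>"
  shows "uniformly_continuous_on {0..} (\<lambda>t. dissipation n (\<Gamma> t))"
  unfolding dissipation_def
proof (rule uniformly_continuous_on_sum)
  fix i assume i: "i \<in> {1..n}"
  define S where "S = (sphere 0 1 :: (real ^ 3) set)"
  define triples where "triples = (SIGMA a:S. SIGMA b:S. S)"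
  define \<phi> where "\<phi> = (\<lambda>(a, b, c). tangent_part b (a + c) \<bullet> tangent_part b (a + c))"
  define p where "p t = (\<Gamma> t (prev_idx n i), \<Gamma> t i, \<Gamma> t (next_idx n i))" for t
  note lip = trajectory_lipschitz[OF N tr]
  have "uniformly_continuous_on {0..} p"
    unfolding p_def
    by (rule lipschitz_on_uniformly_continuous)
       (rule lipschitz_on_Pair[OF lip[OF prev_idx_in[OF i]] lipschitz_on_Pair[OF lip[OF i] lip[OF next_idx_in[OF i]]]])
  moreover have "uniformly_continuous_on (p ` {0..}) \<phi>"
  proof -
    have "uniformly_continuous_on triples \<phi>"
    proof (rule compact_uniformly_continuous)
      show "continuous_on triples \<phi>"
        unfolding \<phi>_def tangent_part_def case_prod_unfold by (intro continuous_intros)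
      show "compact triples"
        unfolding triples_def S_def by (intro compact_Times compact_sphere)
    qed
    moreover have "p ` {0..} \<subseteq> triples"
      using S2_powD(1)[OF trajectoryD(1)[OF tr]] i next_idx_in[OF i] prev_idx_in[OF i]
      by (auto simp: p_def triples_def S_def)
    ultimately show ?thesis
      unfolding uniformly_continuous_on_def by (meson subsetD)
  qed
  ultimately have "uniformly_continuous_on {0..} (\<lambda>t. \<phi> (p t))"
    by (rule uniformly_continuous_on_compose)
  then show "uniformly_continuous_on {0..} (\<lambda>t. ring_defect n (\<Gamma> t) i \<bullet> ring_defect n (\<Gamma> t) i)"
    by (simp add: \<phi>_def p_def ring_defect_def)
qed

lemma continuous_on_dissipation: "continuous_on A (dissipation n)"
  unfolding dissipation_def ring_defect_def tangent_part_def
  by (intro continuous_intros continuous_on_product_then_coordinatewise[OF continuous_on_id])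

section \<open>Distances and compactness\<close>

lemma dist_S2_nonneg:
  assumes "norm x = 1" "norm y = 1"
  shows "0 \<le> dist_S2 x y"
  using inner_unit_bounds[OF assms] by (simp add: dist_S2_def arccos_lbound)

lemma dist_S2_pow_less_iff:
  assumes "n \<ge> 1"
  shows "dist_S2_pow n \<Gamma> \<Gamma>' < e \<longleftrightarrow> (\<forall>i\<in>{1..n}. dist_S2 (\<Gamma> i) (\<Gamma>' i) < e)"
  unfolding dist_S2_pow_def using assms by (subst Max_less_iff) auto

lemma dist_S2_pow_nonneg:
  assumes "n \<ge> 1" "\<Gamma> \<in> S2_pow n" "\<Gamma>' \<in> S2_pow n"
  shows "0 \<le> dist_S2_pow n \<Gamma> \<Gamma>'"
proof -
  have "0 \<le> dist_S2 (\<Gamma> 1) (\<Gamma>' 1)"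
    using assms by (intro dist_S2_nonneg S2_powD(1)) auto
  also have "\<dots> \<le> dist_S2_pow n \<Gamma> \<Gamma>'"
    unfolding dist_S2_pow_def using assms(1) by (intro Max_ge) auto
  finally show ?thesis .
qed

lemma bdd_below_dist_S2_pow:
  assumes "n \<ge> 1" "\<Gamma> \<in> S2_pow n" "M \<subseteq> S2_pow n"
  shows "bdd_below (dist_S2_pow n \<Gamma> ` M)"
  using dist_S2_pow_nonneg[OF assms(1,2)] assms(3) by (intro bdd_belowI[of _ 0]) auto

lemma dist_to_set_nonneg:
  assumes "n \<ge> 1" "\<Gamma> \<in> S2_pow n" "M \<subseteq> S2_pow n" "M \<noteq> {}"
  shows "0 \<le> dist_to_set n M \<Gamma>"
  unfolding dist_to_set_def
  using dist_S2_pow_nonneg[OF assms(1,2)] assms(3,4) by (intro cINF_greatest) auto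

lemma dist_to_set_less_iff:
  assumes "n \<ge> 1" "\<Gamma> \<in> S2_pow n" "M \<subseteq> S2_pow n" "M \<noteq> {}"
  shows "dist_to_set n M \<Gamma> < e \<longleftrightarrow> (\<exists>\<Gamma>'\<in>M. dist_S2_pow n \<Gamma> \<Gamma>' < e)"
  unfolding dist_to_set_def using assms by (intro cINF_less_iff bdd_below_dist_S2_pow) auto

text \<open>The points of \<open>K\<close> outside an open neighbourhood of \<open>M\<close> form a compact set, on which \<open>f\<close> has a
  positive minimum. The neighbourhood is described by inequalities between inner products, which are visibly
  open conditions in the product topology.\<close>

lemma near_zero_set_if_small:
  fixes f :: "config \<Rightarrow> real"
  assumes n: "n \<ge> 1" and K: "compact K" "K \<subseteq> S2_pow n" and f: "continuous_on K f"
    and M: "M \<subseteq> S2_pow n" "M \<noteq> {}"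
    and zero: "\<And>\<Gamma>. \<lbrakk>\<Gamma> \<in> K; f \<Gamma> \<le> 0\<rbrakk> \<Longrightarrow> \<Gamma> \<in> M" and e: "0 < e"
  obtains \<eta> where "0 < \<eta>" "\<And>\<Gamma>. \<lbrakk>\<Gamma> \<in> K; f \<Gamma> < \<eta>\<rbrakk> \<Longrightarrow> dist_to_set n M \<Gamma> < e"
proof -
  \<comment> \<open>The cosine is decreasing only up to \<open>pi\<close>.\<close>
  define e' where "e' = min e pi"
  have e': "0 < e'" "e' \<le> pi" "e' \<le> e" using e by (auto simp: e'_def)
  define U where "U = (\<Union>\<Gamma>'\<in>M. \<Inter>i\<in>{1..n}. {\<Gamma>. cos e' < \<Gamma> i \<bullet> \<Gamma>' i})"
  have "open U"
    unfolding U_def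
    by (intro open_UN ballI open_INT finite_atLeastAtMost open_Collect_less continuous_intros
        continuous_on_product_then_coordinatewise[OF continuous_on_id])
  then have cpt: "compact (K - U)" using K(1) by (intro compact_diff)
  have near: "dist_to_set n M \<Gamma> < e" if \<Gamma>: "\<Gamma> \<in> K" "\<Gamma> \<in> U" for \<Gamma>
  proof -
    obtain \<Gamma>' where \<Gamma>': "\<Gamma>' \<in> M" "\<And>i. i \<in> {1..n} \<Longrightarrow> cos e' < \<Gamma> i \<bullet> \<Gamma>' i"
      using \<Gamma>(2) by (auto simp: U_def)
    have "dist_S2 (\<Gamma> i) (\<Gamma>' i) < e" if i: "i \<in> {1..n}" for i
    proof -
      have "\<Gamma> i \<bullet> \<Gamma>' i \<le> 1"
        using K(2) \<Gamma>(1) \<Gamma>'(1) M(1) i by (intro inner_unit_bounds S2_powD(1)) auto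
      then have "arccos (\<Gamma> i \<bullet> \<Gamma>' i) < arccos (cos e')"
        using \<Gamma>'(2)[OF i] by (intro arccos_less_arccos) auto
      then show ?thesis using e' by (simp add: dist_S2_def arccos_cos)
    qed
    then have "dist_S2_pow n \<Gamma> \<Gamma>' < e" using dist_S2_pow_less_iff[OF n] by blast
    then show ?thesis
      using dist_to_set_less_iff[OF n _ M] K(2) \<Gamma>(1) \<Gamma>'(1) by blast
  qed
  have pos: "0 < f \<Gamma>" if \<Gamma>: "\<Gamma> \<in> K - U" for \<Gamma>
  proof (rule ccontr)
    assume "\<not> 0 < f \<Gamma>"
    then have "\<Gamma> \<in> M" using zero \<Gamma> by auto
    moreover have "cos e' < \<Gamma> i \<bullet> \<Gamma> i" if "i \<in> {1..n}" for i
      using S2_powD(2)[of \<Gamma> n i] K(2) \<Gamma> that e' cos_monotone_0_pi[of 0 e'] by auto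
    ultimately have "\<Gamma> \<in> U" by (auto simp: U_def intro!: bexI[of _ \<Gamma>])
    then show False using \<Gamma> by simp
  qed
  show ?thesis
  proof (cases "K - U = {}")
    case True
    then show ?thesis using near by (intro that[of 1]) auto
  next
    case False
    obtain \<Gamma>0 where "\<Gamma>0 \<in> K - U" "\<And>\<Gamma>. \<Gamma> \<in> K - U \<Longrightarrow> f \<Gamma>0 \<le> f \<Gamma>"
      using continuous_attains_inf[OF cpt False continuous_on_subset[OF f Diff_subset]] by blast
    then show ?thesis using near pos by (intro that[of "f \<Gamma>0"]) force+
  qed
qed

lemma norm_diff_le_dist_S2:
  assumes "norm x = 1" "norm y = 1"
  shows "norm (x - y) \<le> dist_S2 x y"
proof (rule power2_le_imp_le)
  have "(norm (x - y))\<^sup>2 = 2 - 2 * (x \<bullet> y)"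
    using assms by (simp add: power2_norm_eq_inner inner_diff_left inner_diff_right inner_commute norm_eq_1)
  also have "x \<bullet> y = cos (dist_S2 x y)"
    using inner_unit_bounds[OF assms] by (simp add: dist_S2_def)
  also have "2 - 2 * cos (dist_S2 x y) \<le> (dist_S2 x y)\<^sup>2"
    using cos_ge_quadratic[of "dist_S2 x y"] by simp
  finally show "(norm (x - y))\<^sup>2 \<le> (dist_S2 x y)\<^sup>2" .
qed (rule dist_S2_nonneg[OF assms])

lemma edge_cos_close:
  assumes n: "n \<ge> 1" and \<Gamma>: "\<Gamma> \<in> S2_pow n" and \<Gamma>': "\<Gamma>' \<in> S2_pow n"
    and close: "dist_S2_pow n \<Gamma> \<Gamma>' < e" and i: "i \<in> {1..n}"
  shows "\<bar>edge_cos n \<Gamma> i - edge_cos n \<Gamma>' i\<bar> < 2 * e"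
proof -
  let ?k = "next_idx n i"
  note k = next_idx_in[OF i]
  have d: "norm (\<Gamma> j - \<Gamma>' j) < e" if "j \<in> {1..n}" for j
    using norm_diff_le_dist_S2[OF S2_powD(1)[OF \<Gamma> that] S2_powD(1)[OF \<Gamma>' that]] close
    unfolding dist_S2_pow_less_iff[OF n] using that by (meson le_less_trans)
  have "edge_cos n \<Gamma> i - edge_cos n \<Gamma>' i = (\<Gamma> i - \<Gamma>' i) \<bullet> \<Gamma> ?k + \<Gamma>' i \<bullet> (\<Gamma> ?k - \<Gamma>' ?k)"
    by (simp add: edge_cos_def inner_diff_left inner_diff_right)
  moreover have "\<bar>(\<Gamma> i - \<Gamma>' i) \<bullet> \<Gamma> ?k\<bar> \<le> norm (\<Gamma> i - \<Gamma>' i)"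
    using Cauchy_Schwarz_ineq2[of "\<Gamma> i - \<Gamma>' i" "\<Gamma> ?k"] S2_powD(1)[OF \<Gamma> k] by simp
  moreover have "\<bar>\<Gamma>' i \<bullet> (\<Gamma> ?k - \<Gamma>' ?k)\<bar> \<le> norm (\<Gamma> ?k - \<Gamma>' ?k)"
    using Cauchy_Schwarz_ineq2[of "\<Gamma>' i" "\<Gamma> ?k - \<Gamma>' ?k"] S2_powD(1)[OF \<Gamma>' i] by simp
  ultimately show ?thesis using d[OF i] d[OF k] by linarith
qed

lemma energy_close:
  assumes n: "n \<ge> 1" and \<Gamma>: "\<Gamma> \<in> S2_pow n" and \<Gamma>': "\<Gamma>' \<in> S2_pow n"
    and close: "dist_S2_pow n \<Gamma> \<Gamma>' < e"
  shows "energy n \<Gamma> < energy n \<Gamma>' + 2 * real n * e"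
proof -
  have "energy n \<Gamma> < (\<Sum>i\<in>{1..n}. edge_cos n \<Gamma>' i + 2 * e)"
    unfolding energy_def
  proof (rule sum_strict_mono)
    fix i assume "i \<in> {1..n}"
    from edge_cos_close[OF assms this] show "edge_cos n \<Gamma> i < edge_cos n \<Gamma>' i + 2 * e" by linarith
  qed (use n in auto)
  then show ?thesis by (simp add: energy_def sum.distrib algebra_simps)
qed

section \<open>Stability and attraction\<close>

lemma M_o_subset: "M_o n \<subseteq> S2_pow n"
  by (auto simp: M_o_def)

lemma energy_nonincreasing:
  assumes n: "n \<ge> 3" and N: "N = undirected_ring n \<or> N = directed_ring n"
    and tr: "trajectory n (closed_loop N) \<Gamma>" and st: "0 \<le> s" "s \<le> t"
  shows "energy n (\<Gamma> t) \<le> energy n (\<Gamma> s)"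
proof -
  obtain \<kappa> :: real where \<kappa>: "0 < \<kappa>" and deriv: "\<And>t. 0 \<le> t \<Longrightarrow>
       ((\<lambda>s. energy n (\<Gamma> s)) has_real_derivative - \<kappa> * dissipation n (\<Gamma> t)) (at t within {0..})"
    using energy_derivative[OF n N] tr by metis
  show ?thesis
    using \<kappa> dissipation_nonneg
    by (intro nonincreasing_of_derivative_nonpos[OF deriv _ st]) (auto intro: mult_nonneg_nonneg)
qed

text \<open>The energy never increases and has \<open>M_o n\<close> as its set of global minimizers. So \<open>M_o n\<close> is
  invariant, a start close to \<open>M_o n\<close> means an energy close to the minimum for all time, and by
  compactness small excess energy forces the configuration to be close to \<open>M_o n\<close>.\<close>

lemma stable_M_o:
  assumes n: "n \<ge> 3" and odd: "odd n" and N: "N = undirected_ring n \<or> N = directed_ring n"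
  shows "stable_set n (closed_loop N) (M_o n)"
  unfolding stable_set_def positively_invariant_def
proof (intro conjI allI impI M_o_subset)
  fix \<Gamma> and t :: real
  assume tr: "trajectory n (closed_loop N) \<Gamma>" and "\<Gamma> 0 \<in> M_o n" and t: "0 \<le> t"
  then have "energy n (\<Gamma> t) \<le> - real n * cos (pi / real n)"
    using energy_nonincreasing[OF n N tr order_refl t] energy_M_o[OF n odd] by simp
  then show "\<Gamma> t \<in> M_o n"
    using energy_minimum[OF n odd trajectoryD(1)[OF tr t]] by auto
next
  fix e :: real assume e: "0 < e"
  have n1: "n \<ge> 1" using n by simp
  define f where "f \<Gamma> = energy n \<Gamma> + real n * cos (pi / real n)" for \<Gamma>
  have "continuous_on (S2_pow n) f"
    unfolding f_def by (intro continuous_intros continuous_on_energy)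
  moreover have "\<Gamma> \<in> M_o n" if "\<Gamma> \<in> S2_pow n" "f \<Gamma> \<le> 0" for \<Gamma>
    using energy_minimum[OF n odd that(1)] that(2) by (auto simp: f_def)
  ultimately obtain \<eta> where \<eta>: "0 < \<eta>"
    and near: "\<And>\<Gamma>. \<lbrakk>\<Gamma> \<in> S2_pow n; f \<Gamma> < \<eta>\<rbrakk> \<Longrightarrow> dist_to_set n (M_o n) \<Gamma> < e"
    using near_zero_set_if_small[OF n1 compact_S2_pow order_refl _ M_o_subset M_o_nonempty _ e] by blast
  show "\<exists>\<delta>>0. \<forall>\<Gamma>. trajectory n (closed_loop N) \<Gamma> \<longrightarrow> dist_to_set n (M_o n) (\<Gamma> 0) < \<delta> \<longrightarrow>
        (\<forall>t\<ge>0. dist_to_set n (M_o n) (\<Gamma> t) < e)"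
  proof (intro exI[of _ "\<eta> / (2 * real n)"] conjI allI impI)
    show "0 < \<eta> / (2 * real n)" using \<eta> n by simp
    fix \<Gamma> and t :: real
    assume tr: "trajectory n (closed_loop N) \<Gamma>" and t: "0 \<le> t"
      and "dist_to_set n (M_o n) (\<Gamma> 0) < \<eta> / (2 * real n)"
    then obtain \<Gamma>' where \<Gamma>': "\<Gamma>' \<in> M_o n" "dist_S2_pow n (\<Gamma> 0) \<Gamma>' < \<eta> / (2 * real n)"
      using dist_to_set_less_iff[OF n1 trajectoryD(1)[OF tr order_refl] M_o_subset M_o_nonempty] by blast
    have "energy n (\<Gamma> t) \<le> energy n (\<Gamma> 0)"
      by (rule energy_nonincreasing[OF n N tr order_refl t])
    also have "\<dots> < energy n \<Gamma>' + 2 * real n * (\<eta> / (2 * real n))"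
      using \<Gamma>' M_o_subset by (intro energy_close[OF n1 trajectoryD(1)[OF tr order_refl]]) auto
    finally have "f (\<Gamma> t) < \<eta>"
      using n energy_M_o[OF n odd \<Gamma>'(1)] by (simp add: f_def)
    then show "dist_to_set n (M_o n) (\<Gamma> t) < e"
      by (rule near[OF trajectoryD(1)[OF tr t]])
  qed
qed

lemma W_greater_iff:
  assumes "n \<ge> 1"
  shows "x < W n \<Gamma> \<longleftrightarrow> (\<forall>i\<in>{1..n}. x < arccos (edge_cos n \<Gamma> i))"
  unfolding W_def dist_S2_def edge_cos_def using assms by (subst Min_gr_iff) auto

text \<open>On \<open>M_o n\<close> every edge has length \<open>pi - pi / n\<close>, strictly above the threshold \<open>\<mu>\<close> that defines
  \<open>Omega_o n\<close>, and edge cosines depend continuously on the configuration.\<close>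

lemma neighborhood_Omega_o:
  assumes n: "n \<ge> 3" and odd: "odd n"
  shows "contains_neighborhood n (Omega_o n) (M_o n)"
  unfolding contains_neighborhood_def
proof
  fix \<Gamma> assume \<Gamma>: "\<Gamma> \<in> M_o n"
  have n1: "n \<ge> 1" using n by simp
  define \<mu> where "\<mu> = max (pi - 3 * pi / real n) (pi / 2)"
  have "pi / real n < pi / 2" "pi / real n < 3 * pi / real n" "pi / real n \<le> pi" "0 \<le> pi / real n"
    using n by (auto simp: field_simps)
  then have \<mu>: "0 \<le> \<mu>" "\<mu> < pi - pi / real n" "\<mu> \<le> pi"
    using pi_gt_zero by (auto simp: \<mu>_def)
  define e where "e = (cos \<mu> + cos (pi / real n)) / 2"
  have "cos (pi - pi / real n) < cos \<mu>"
    using \<mu> \<open>0 \<le> pi / real n\<close> by (intro cos_monotone_0_pi) auto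
  then have e: "0 < e" by (simp add: e_def)
  have "\<Gamma>' \<in> Omega_o n" if \<Gamma>': "\<Gamma>' \<in> S2_pow n" and close: "dist_S2_pow n \<Gamma> \<Gamma>' < e" for \<Gamma>'
  proof -
    have "\<mu> < arccos (edge_cos n \<Gamma>' i)" if i: "i \<in> {1..n}" for i
    proof -
      have "\<Gamma> \<in> S2_pow n" using \<Gamma> M_o_subset by blast
      from edge_cos_close[OF n1 this \<Gamma>' close i]
      have "edge_cos n \<Gamma>' i - edge_cos n \<Gamma> i < 2 * e"
        by linarith
      then have "edge_cos n \<Gamma>' i < cos \<mu>"
        by (simp add: M_o_edge_cos[OF n odd \<Gamma> i] e_def)
      then have "arccos (cos \<mu>) < arccos (edge_cos n \<Gamma>' i)"
        using edge_cos_bounds[OF \<Gamma>' i] by (intro arccos_less_arccos) auto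
      then show ?thesis using \<mu> by (simp add: arccos_cos)
    qed
    then have "\<mu> < W n \<Gamma>'" using W_greater_iff[OF n1] by blast
    then show ?thesis using \<Gamma>' by (simp add: Omega_o_def \<mu>_def)
  qed
  then show "\<exists>\<epsilon>>0. \<forall>\<Gamma>'\<in>S2_pow n. dist_S2_pow n \<Gamma> \<Gamma>' < \<epsilon> \<longrightarrow> \<Gamma>' \<in> Omega_o n"
    using e by blast
qed

text \<open>The barrier principle for the negated edge cosines: the shortest edge, as long as it is obtuse, is not
  being shortened.\<close>

lemma edge_cos_barrier:
  assumes n: "n \<ge> 3" and N: "N = undirected_ring n \<or> N = directed_ring n"
    and tr: "trajectory n (closed_loop N) \<Gamma>" and g: "g < 0"
    and init: "\<And>i. i \<in> {1..n} \<Longrightarrow> edge_cos n (\<Gamma> 0) i \<le> g"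
    and i: "i \<in> {1..n}" and t: "0 \<le> t"
  shows "edge_cos n (\<Gamma> t) i \<le> g"
proof -
  have "- g \<le> - edge_cos n (\<Gamma> t) i"
  proof (rule minimum_barrier[where I = "{1..n}" and f = "\<lambda>i t. - edge_cos n (\<Gamma> t) i"
        and f' = "\<lambda>i t. - edge_rate n (closed_loop N) (\<Gamma> t) i"])
    fix i and t :: real assume i: "i \<in> {1..n}" and t: "0 \<le> t"
    show "((\<lambda>t. - edge_cos n (\<Gamma> t) i) has_real_derivative - edge_rate n (closed_loop N) (\<Gamma> t) i)
        (at t within {0..})"
      by (intro DERIV_minus edge_cos_derivative[OF tr t i])
    assume "0 < - edge_cos n (\<Gamma> t) i"
      and "\<And>j. j \<in> {1..n} \<Longrightarrow> - edge_cos n (\<Gamma> t) i \<le> - edge_cos n (\<Gamma> t) j"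
    then show "0 \<le> - edge_rate n (closed_loop N) (\<Gamma> t) i"
      using edge_rate_nonpos_at_shortest_edge[OF n N trajectoryD(1)[OF tr t] i] by auto
  qed (use g init i t in auto)
  then show ?thesis by simp
qed

text \<open>The energy is monotone and bounded, hence convergent, and the dissipation is proportional to its
  derivative.\<close>

lemma dissipation_tends_to_0:
  assumes n: "n \<ge> 3" and odd: "odd n" and N: "N = undirected_ring n \<or> N = directed_ring n"
    and tr: "trajectory n (closed_loop N) \<Gamma>"
  shows "((\<lambda>t. dissipation n (\<Gamma> t)) \<longlongrightarrow> 0) at_top"
proof -
  obtain \<kappa> :: real where \<kappa>: "0 < \<kappa>" and deriv: "\<And>t. 0 \<le> t \<Longrightarrow>
       ((\<lambda>s. energy n (\<Gamma> s)) has_real_derivative - \<kappa> * dissipation n (\<Gamma> t)) (at t within {0..})"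
    using energy_derivative[OF n N] tr by metis
  obtain l where lim: "((\<lambda>t. energy n (\<Gamma> t)) \<longlongrightarrow> l) at_top"
  proof (rule nonincreasing_bounded_below_converges)
    show "energy n (\<Gamma> t) \<le> energy n (\<Gamma> s)" if "0 \<le> s" "s \<le> t" for s t
      by (rule energy_nonincreasing[OF n N tr that])
    show "- real n * cos (pi / real n) \<le> energy n (\<Gamma> t)" if "0 \<le> t" for t
      by (rule energy_minimum(1)[OF n odd trajectoryD(1)[OF tr that]])
  qed
  have "uniformly_continuous_on {0..} (\<lambda>t. - \<kappa> * dissipation n (\<Gamma> t))"
    by (rule bounded_linear.uniformly_continuous_on[OF bounded_linear_mult_right
          uniformly_continuous_dissipation[OF N tr]])
  from barbalat[OF deriv this lim] have "((\<lambda>t. - \<kappa> * dissipation n (\<Gamma> t)) \<longlongrightarrow> 0) at_top" .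
  from tendsto_mult[OF tendsto_const[of "- 1 / \<kappa>"] this] show ?thesis
    using \<kappa> by simp
qed

text \<open>The trajectory stays in the compact set \<open>K\<close> of configurations whose edges are at least as long as
  the shortest initial one. In \<open>K\<close> the dissipation vanishes only on \<open>M_o n\<close>: the edges there are
  obtuse, so equal squares of cosines mean equal edges, and the classification of critical
  configurations applies. As the dissipation tends to 0, compactness of \<open>K\<close> gives the claim.\<close>

lemma M_o_attracts_Omega_o:
  assumes n: "n \<ge> 3" and odd: "odd n" and N: "N = undirected_ring n \<or> N = directed_ring n"
    and tr: "trajectory n (closed_loop N) \<Gamma>" and start: "\<Gamma> 0 \<in> Omega_o n"
  shows "((\<lambda>t. dist_to_set n (M_o n) (\<Gamma> t)) \<longlongrightarrow> 0) at_top"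
proof (rule tendstoI)
  fix e :: real assume e: "0 < e"
  have n1: "n \<ge> 1" using n by simp
  have \<Gamma>0: "\<Gamma> 0 \<in> S2_pow n" by (rule trajectoryD(1)[OF tr order_refl])
  define g where "g = Max (edge_cos n (\<Gamma> 0) ` {1..n})"
  have le_g: "edge_cos n (\<Gamma> 0) i \<le> g" if "i \<in> {1..n}" for i
    unfolding g_def using that by (intro Max_ge) auto
  have "g \<in> edge_cos n (\<Gamma> 0) ` {1..n}"
    unfolding g_def using n by (intro Max_in) auto
  then obtain k where k: "k \<in> {1..n}" "g = edge_cos n (\<Gamma> 0) k" by blast
  have g_bounds: "- 1 \<le> g" "g \<le> 1"
    using edge_cos_bounds[OF \<Gamma>0 k(1)] k(2) by auto
  have "max (pi - 3 * pi / real n) (pi / 2) < W n (\<Gamma> 0)"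
    using start by (simp add: Omega_o_def)
  then have "max (pi - 3 * pi / real n) (pi / 2) < arccos g"
    unfolding W_greater_iff[OF n1] k(2) using k(1) by blast
  then have g_arc: "pi - 3 * pi / real n < arccos g" "pi / 2 < arccos g" by auto
  have "cos (arccos g) < cos (pi / 2)"
    using g_arc(2) arccos_ubound[OF g_bounds] by (intro cos_monotone_0_pi) auto
  then have g_neg: "g < 0" using g_bounds by simp
  define K where "K = S2_pow n \<inter> (\<Inter>i\<in>{1..n}. {\<Gamma>. edge_cos n \<Gamma> i \<le> g})"
  have in_K: "\<Gamma> t \<in> K" if "0 \<le> t" for t
    using trajectoryD(1)[OF tr that] edge_cos_barrier[OF n N tr g_neg le_g _ that] by (auto simp: K_def)
  have K: "compact K" "K \<subseteq> S2_pow n"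
    unfolding K_def
    by (auto intro!: compact_Int_closed compact_S2_pow closed_INT closed_Collect_le continuous_intros)
  have "\<Gamma>' \<in> M_o n" if \<Gamma>': "\<Gamma>' \<in> K" "dissipation n \<Gamma>' \<le> 0" for \<Gamma>'
  proof -
    have S: "\<Gamma>' \<in> S2_pow n" and le: "\<And>i. i \<in> {1..n} \<Longrightarrow> edge_cos n \<Gamma>' i \<le> g"
      using \<Gamma>'(1) by (auto simp: K_def)
    have "dissipation n \<Gamma>' = 0" using \<Gamma>'(2) dissipation_nonneg[of n \<Gamma>'] by linarith
    then have defect: "ring_defect n \<Gamma>' i = 0" if "i \<in> {1..n}" for i
      using that unfolding dissipation_def by (subst (asm) sum_nonneg_eq_0_iff) auto
    have one: "1 \<in> {1..n}" using n by simp
    have edges: "edge_cos n \<Gamma>' i = edge_cos n \<Gamma>' 1" if i: "i \<in> {1..n}" for i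
      using edge_cos_square_constant[OF S defect i] le[OF i] le[OF one] g_neg
      by (auto simp: power2_eq_iff)
    have "arccos g \<le> arccos (edge_cos n \<Gamma>' 1)"
      using le[OF one] edge_cos_bounds[OF S one] g_bounds by (intro arccos_le_arccos) auto
    then show ?thesis
      using g_arc(1) by (intro critical_equal_edges_in_M_o[OF n odd S defect edges]) auto
  qed
  then obtain \<eta> where \<eta>: "0 < \<eta>"
    and near: "\<And>\<Gamma>. \<lbrakk>\<Gamma> \<in> K; dissipation n \<Gamma> < \<eta>\<rbrakk> \<Longrightarrow> dist_to_set n (M_o n) \<Gamma> < e"
    using near_zero_set_if_small[OF n1 K continuous_on_dissipation M_o_subset M_o_nonempty _ e] by blast
  have "eventually (\<lambda>t. dissipation n (\<Gamma> t) < \<eta>) at_top"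
    using order_tendstoD(2)[OF dissipation_tends_to_0[OF n odd N tr] \<eta>] .
  moreover have "eventually (\<lambda>t::real. 0 \<le> t) at_top"
    by (rule eventually_ge_at_top)
  ultimately show "eventually (\<lambda>t. dist (dist_to_set n (M_o n) (\<Gamma> t)) 0 < e) at_top"
  proof eventually_elim
    case (elim t)
    then show ?case
      using near[OF in_K] dist_to_set_nonneg[OF n1 trajectoryD(1)[OF tr] M_o_subset M_o_nonempty]
      by (simp add: dist_real_def)
  qed
qed

theorem theorem5p4:
  fixes n :: nat and N :: "nat \<Rightarrow> nat set"
  assumes "n \<ge> 3" and "odd n"
    and "N = undirected_ring n \<or> N = directed_ring n"
  shows "asymptotically_stable_on n (closed_loop N) (M_o n) (Omega_o n)"
  unfolding asymptotically_stable_on_def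
  using stable_M_o[OF assms] neighborhood_Omega_o[OF assms(1,2)] M_o_attracts_Omega_o[OF assms]
  by blast

end
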